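(* For a parameter $\mathbf{p}\in\{\mathbf{cmms},\mathbf{cms}\}$ let $\mathbf{obs}_{\preceq}(\mathcal{G}[\mathbf{p},2])$ be the set of all connected graphs $G$ (up to isomorphism) such that $\mathbf{p}(G)>2$ and $\mathbf{p}(H)\le 2$ for every proper contraction $H$ of $G$. Then $$\mathbf{obs}_{\preceq}(\mathcal{G}[\mathbf{cmms},2])=\mathbf{obs}_{\preceq}(\mathcal{G}[\mathbf{cms},2]).$$
   Context: All graphs are finite, without loops or multiple edges. A graph $H$ is a contraction of $G$, written $H\preceq G$, if there is a surjection $\phi:V(G)\to V(H)$ such that $G[\phi^{-1}(v)]$ is connected for every $v\in V(H)$ and, for all distinct $u,v\in V(H)$, $\{u,v\}\in E(H)$ if and only if $G[\phi^{-1}(u)\cup\phi^{-1}(v)]$ is connected. It is a proper contraction if moreover $H$ is not isomorphic to $G$. A (mixed) search strategy on $G$ is a finite sequence $\mathcal{S}$ of moves, starting with no searchers on the graph, each of one of the types: placing a new searcher on a vertex $v$; deleting a searcher from a vertex $v$; sliding a searcher from $v$ along an edge $\{v,u\}$ and placing it on $u$. Set $E(\mathcal{S},0)=\emptyset$. For $i>0$, let $E^{(i)}$ be the set of edges cleaned by the $i$-th move, i.e. edges both of whose endpoints become occupied by searchers, and the edge along which a searcher slides in that move. Let $Q_i=E(\mathcal{S},i-1)\cup E^{(i)}$. Then $E(\mathcal{S},i)$ (the set of clean edges after $i$ moves) is $Q_i$ minus those edges $e$ for which there is a path starting from $e$ and finishing in an edge not in $Q_i$ such that no two consecutive edges of it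 meet at a vertex occupied by a searcher after the $i$-th move. The $i$-th move is a recontamination move if $E(\mathcal{S},i)\subsetneq Q_i$. The strategy is complete if $E(\mathcal{S},i)=E(G)$ for some $i$, monotone if it has no recontamination moves, and connected if for every $i$ the subgraph of $G$ formed by the edges in $E(\mathcal{S},i)$ and their endpoints is connected (the empty graph counts as connected). The number of searchers used by $\mathcal{S}$ is the maximum number of searchers on the graph during any move. For a connected graph $G$, $\mathbf{cms}(G)$ is the minimum number of searchers used by a complete connected search strategy on $G$, and $\mathbf{cmms}(G)$ is the minimum number of searchers used by a complete connected monotone search strategy on $G$ (both are $0$ if $G$ has no edges). *)

theory Defs
  imports Main "HOL-Library.Multiset"
begin

datatype 'a graph = Graph (verts: "'a set") (edges: "'a set set")

definition simple_graph :: "'a graph \<Rightarrow> bool" where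
  "simple_graph G \<longleftrightarrow>
     finite (verts G) \<and> (\<forall>e\<in>edges G. e \<subseteq> verts G \<and> card e = 2)"

definition induced_subgraph :: "'a graph \<Rightarrow> 'a set \<Rightarrow> 'a graph" where
  "induced_subgraph G W = Graph (verts G \<inter> W) {e \<in> edges G. e \<subseteq> W}"

definition edge_subgraph :: "'a set set \<Rightarrow> 'a graph" where
  "edge_subgraph F = Graph (\<Union>F) F"

(* The graph without vertices is connected. *)
definition connected_graph :: "'a graph \<Rightarrow> bool" where
  "connected_graph G \<longleftrightarrow>
     (\<forall>u\<in>verts G. \<forall>v\<in>verts G. (u, v) \<in> {(x, y). {x, y} \<in> edges G}\<^sup>*)"

definition isomorphic :: "'a graph \<Rightarrow> 'b graph \<Rightarrow> bool" where
  "isomorphic G H \<longleftrightarrow>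
     (\<exists>f. bij_betw f (verts G) (verts H) \<and>
          (\<forall>u\<in>verts G. \<forall>v\<in>verts G. {u, v} \<in> edges G \<longleftrightarrow> {f u, f v} \<in> edges H))"

definition contraction :: "'b graph \<Rightarrow> 'a graph \<Rightarrow> bool" (infix "\<preceq>\<^sub>c" 50) where
  "H \<preceq>\<^sub>c G \<longleftrightarrow> simple_graph H \<and> simple_graph G \<and>
     (\<exists>\<phi>. \<phi> ` verts G = verts H \<and>
       (\<forall>v\<in>verts H. connected_graph (induced_subgraph G {x \<in> verts G. \<phi> x = v})) \<and>
       (\<forall>u\<in>verts H. \<forall>v\<in>verts H. u \<noteq> v \<longrightarrow>
          ({u, v} \<in> edges H \<longleftrightarrow>
           connected_graph (induced_subgraph G {x \<in> verts G. \<phi> x = u \<or> \<phi> x = v}))))"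

definition proper_contraction :: "'b graph \<Rightarrow> 'a graph \<Rightarrow> bool" where
  "proper_contraction H G \<longleftrightarrow> H \<preceq>\<^sub>c G \<and> \<not> isomorphic H G"

(* Slide v u moves a searcher from v to u. *)
datatype 'a move = Place 'a | Delete 'a | Slide 'a 'a

(* Several searchers may stand on the same vertex, so positions are multisets. *)
fun legal_move :: "'a graph \<Rightarrow> 'a multiset \<Rightarrow> 'a move \<Rightarrow> bool" where
  "legal_move G M (Place v) \<longleftrightarrow> v \<in> verts G"
| "legal_move G M (Delete v) \<longleftrightarrow> v \<in># M"
| "legal_move G M (Slide v u) \<longleftrightarrow> v \<in># M \<and> {v, u} \<in> edges G"

fun apply_move :: "'a move \<Rightarrow> 'a multiset \<Rightarrow> 'a multiset" where
  "apply_move (Place v) M = add_mset v M"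
| "apply_move (Delete v) M = M - {#v#}"
| "apply_move (Slide v u) M = add_mset u (M - {#v#})"

fun slid_edges :: "'a move \<Rightarrow> 'a set set" where
  "slid_edges (Slide v u) = {{v, u}}"
| "slid_edges _ = {}"

(* Positions of the searchers after i moves; move number i is S ! (i - 1). *)
primrec searchers :: "'a move list \<Rightarrow> nat \<Rightarrow> 'a multiset" where
  "searchers S 0 = {#}"
| "searchers S (Suc i) = apply_move (S ! i) (searchers S i)"

definition search_strategy :: "'a graph \<Rightarrow> 'a move list \<Rightarrow> bool" where
  "search_strategy G S \<longleftrightarrow> (\<forall>i<length S. legal_move G (searchers S i) (S ! i))"

(* E^(i), for i > 0. An edge whose endpoints were both occupied already before
   move i is clean before that move, so including it here does not change Q_i. *)
definition cleaned_by_move :: "'a graph \<Rightarrow> 'a move list \<Rightarrow> nat \<Rightarrow> 'a set set" where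
  "cleaned_by_move G S i =
     {e \<in> edges G. e \<subseteq> set_mset (searchers S i)} \<union> slid_edges (S ! (i - 1))"

definition graph_path :: "'a graph \<Rightarrow> 'a list \<Rightarrow> bool" where
  "graph_path G p \<longleftrightarrow> distinct p \<and> set p \<subseteq> verts G \<and>
     (\<forall>j. Suc j < length p \<longrightarrow> {p ! j, p ! Suc j} \<in> edges G)"

(* Paths are given by their vertices; two consecutive edges of a path meet
   exactly at an internal vertex of it. *)
definition recontaminated :: "'a graph \<Rightarrow> 'a set \<Rightarrow> 'a set set \<Rightarrow> 'a set \<Rightarrow> bool" where
  "recontaminated G occ Q e \<longleftrightarrow>
     (\<exists>p. graph_path G p \<and> length p \<ge> 2 \<and> {p ! 0, p ! 1} = e \<and>
          {p ! (length p - 2), p ! (length p - 1)} \<notin> Q \<and>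
          (\<forall>j. 0 < j \<and> j < length p - 1 \<longrightarrow> p ! j \<notin> occ))"

(* E(S, i) *)
primrec clean_edges :: "'a graph \<Rightarrow> 'a move list \<Rightarrow> nat \<Rightarrow> 'a set set" where
  "clean_edges G S 0 = {}"
| "clean_edges G S (Suc i) =
     (let Q = clean_edges G S i \<union> cleaned_by_move G S (Suc i)
      in Q - {e. recontaminated G (set_mset (searchers S (Suc i))) Q e})"

(* Move number i, for i > 0. *)
definition recontamination_move :: "'a graph \<Rightarrow> 'a move list \<Rightarrow> nat \<Rightarrow> bool" where
  "recontamination_move G S i \<longleftrightarrow>
     clean_edges G S i \<subset> clean_edges G S (i - 1) \<union> cleaned_by_move G S i"

definition complete_strategy :: "'a graph \<Rightarrow> 'a move list \<Rightarrow> bool" where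
  "complete_strategy G S \<longleftrightarrow> (\<exists>i\<le>length S. clean_edges G S i = edges G)"

definition monotone_strategy :: "'a graph \<Rightarrow> 'a move list \<Rightarrow> bool" where
  "monotone_strategy G S \<longleftrightarrow> (\<forall>i\<in>{1..length S}. \<not> recontamination_move G S i)"

definition connected_strategy :: "'a graph \<Rightarrow> 'a move list \<Rightarrow> bool" where
  "connected_strategy G S \<longleftrightarrow>
     (\<forall>i\<le>length S. connected_graph (edge_subgraph (clean_edges G S i)))"

definition searchers_used :: "'a move list \<Rightarrow> nat" where
  "searchers_used S = Max ((\<lambda>i. size (searchers S i)) ` {..length S})"

(* The minima below exist for every connected simple graph: one may place a
   searcher on every vertex, in an order in which each vertex but the first has
   an earlier neighbour. On edgeless graphs the empty strategy gives 0. *)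
definition cms :: "'a graph \<Rightarrow> nat" where
  "cms G = (LEAST k. \<exists>S. search_strategy G S \<and> complete_strategy G S \<and>
     connected_strategy G S \<and> searchers_used S = k)"

definition cmms :: "'a graph \<Rightarrow> nat" where
  "cmms G = (LEAST k. \<exists>S. search_strategy G S \<and> complete_strategy G S \<and>
     connected_strategy G S \<and> monotone_strategy G S \<and> searchers_used S = k)"

(* Every finite graph has a copy on natural numbers, so graphs up to
   isomorphism are the isomorphism classes of simple graphs on nat. *)
definition iso_rel :: "(nat graph \<times> nat graph) set" where
  "iso_rel = {(G, H). simple_graph G \<and> simple_graph H \<and> isomorphic G H}"

definition contraction_obs :: "(nat graph \<Rightarrow> nat) \<Rightarrow> nat \<Rightarrow> nat graph set set" where
  "contraction_obs p k =
     {G. simple_graph G \<and> connected_graph G \<and> p G > k \<and>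
         (\<forall>H. proper_contraction H G \<longrightarrow> p H \<le> k)} // iso_rel"

end

theory Submission imports Defs begin

text \<open>
  A contraction of a connected graph is connected (\<open>contraction_connected\<close>), so both obstruction
  sets are built from connected graphs only, and it is enough that for a connected graph
  \<open>cms G \<le> 2\<close> holds exactly if \<open>cmms G \<le> 2\<close> (\<open>cmms_le_2_iff\<close>): two searchers who keep the clean
  edges connected gain nothing from recontamination.

  The clean edges form a set \<open>X\<close>, and every vertex of its boundary, that is, every vertex incident
  with a clean and with a dirty edge, must be occupied (\<open>clean_edges_guarded\<close>). An expansion is a
  connected edge set that grows out of the empty set by steps that two searchers can carry out
  without losing an edge; \<open>expansion_reachable\<close> turns an expansion into a monotone strategy. It
  remains to make \<open>E\<close> an expansion whenever some connected strategy with two searchers cleans it.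
  For this, each set \<open>X\<close> of clean edges of the given strategy is covered by an expansion \<open>Y \<supseteq> X\<close> whose
  boundary is not larger than that of \<open>X\<close>; then \<open>X\<close> is called dominated. Domination survives a move
  for two reasons.

  When \<open>X\<close> grows to \<open>X'\<close>, the union \<open>Y \<union> X'\<close> takes the role of \<open>Y\<close>. Its boundary is small because the
  size of the boundary is submodular and \<open>Y \<inter> X'\<close>, which contains \<open>X\<close>, has a boundary that is large
  enough to pay for that of \<open>Y\<close> (\<open>dominated_edge_step\<close>, \<open>dominated_leaf_step\<close>). If \<open>Y\<close> already contains
  \<open>X'\<close>, the next argument applies instead.

  When \<open>X\<close> shrinks to a nonempty set \<open>X'\<close>, the expansion \<open>Y\<close> still contains \<open>X'\<close>, and its boundary can
  be too large only if it has two vertices and the boundary of \<open>X'\<close> is a single vertex \<open>x\<close>. Here the number two is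
  essential. In this case \<open>X'\<close> hangs on the rest of the graph at \<open>x\<close> alone; intersecting all stages of
  \<open>Y\<close> with \<open>X'\<close> amounts to retracting everything outside \<open>X'\<close> onto \<open>x\<close>, which preserves connectedness
  and needs no additional guard. So \<open>X'\<close> is itself an expansion (\<open>expansion_restrict\<close>).
\<close>

section \<open>Connected edge sets\<close>

definition adj :: "'a set set \<Rightarrow> ('a \<times> 'a) set" where
  "adj X = {(x, y). {x, y} \<in> X}"

abbreviation edge_connected :: "'a set set \<Rightarrow> bool" where
  "edge_connected X \<equiv> connected_graph (edge_subgraph X)"

lemma edge_connected_iff:
  "edge_connected X \<longleftrightarrow> (\<forall>u\<in>\<Union>X. \<forall>v\<in>\<Union>X. (u, v) \<in> (adj X)\<^sup>*)"
  unfolding connected_graph_def edge_subgraph_def adj_def by simp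

lemma adj_sym: "(x, y) \<in> adj X \<longleftrightarrow> (y, x) \<in> adj X"
  unfolding adj_def by (simp add: insert_commute)

lemma adj_rtrancl_sym: "(x, y) \<in> (adj X)\<^sup>* \<Longrightarrow> (y, x) \<in> (adj X)\<^sup>*"
  using sym_rtrancl[of "adj X"] adj_sym unfolding sym_def by metis

lemma adj_rtrancl_mono: "(x, y) \<in> (adj X)\<^sup>* \<Longrightarrow> X \<subseteq> Y \<Longrightarrow> (x, y) \<in> (adj Y)\<^sup>*"
  using rtrancl_mono[of "adj X" "adj Y"] unfolding adj_def by blast

lemma rtrancl_image:
  assumes "(a, b) \<in> r\<^sup>*" and "\<And>p q. (p, q) \<in> r \<Longrightarrow> (h p, h q) \<in> s\<^sup>*"
  shows "(h a, h b) \<in> s\<^sup>*"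
  using assms(1) by (induction rule: rtrancl_induct) (auto intro: assms(2) rtrancl_trans)

lemma edge_connected_single: "edge_connected {{u, v}}"
proof -
  have "(u, v) \<in> adj {{u, v}}" unfolding adj_def by simp
  then have uv: "(u, v) \<in> (adj {{u, v}})\<^sup>*" by (rule r_into_rtrancl)
  show ?thesis unfolding edge_connected_iff using uv adj_rtrancl_sym[OF uv] by auto
qed

lemma edge_connected_Un:
  assumes "edge_connected A" "edge_connected B" "\<Union>A \<inter> \<Union>B \<noteq> {}"
  shows "edge_connected (A \<union> B)"
proof -
  obtain z where z: "z \<in> \<Union>A" "z \<in> \<Union>B" using assms(3) by blast
  have toz: "(u, z) \<in> (adj (A \<union> B))\<^sup>*" if "u \<in> \<Union>(A \<union> B)" for u
  proof (cases "u \<in> \<Union>A")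
    case True
    then have "(u, z) \<in> (adj A)\<^sup>*" using assms(1) z(1) unfolding edge_connected_iff by blast
    then show ?thesis by (rule adj_rtrancl_mono) simp
  next
    case False
    then have "(u, z) \<in> (adj B)\<^sup>*" using that assms(2) z(2) unfolding edge_connected_iff by blast
    then show ?thesis by (rule adj_rtrancl_mono) simp
  qed
  show ?thesis unfolding edge_connected_iff
    using toz adj_rtrancl_sym rtrancl_trans by meson
qed

lemma edge_connected_meet:
  assumes "edge_connected (A \<union> B)" "\<Union>A \<noteq> {}" "\<Union>B \<noteq> {}"
  shows "\<Union>A \<inter> \<Union>B \<noteq> {}"
proof
  assume disj: "\<Union>A \<inter> \<Union>B = {}"
  obtain a b where ab: "a \<in> \<Union>A" "b \<in> \<Union>B" using assms by auto
  have "(a, b) \<in> (adj (A \<union> B))\<^sup>*" using assms(1) ab unfolding edge_connected_iff by blast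
  then have "b \<in> \<Union>A"
  proof (induction rule: rtrancl_induct)
    case base
    show ?case using ab by blast
  next
    case (step y z)
    then have "{y, z} \<in> A \<union> B" unfolding adj_def by simp
    then show ?case using step.IH disj by auto
  qed
  then show False using ab disj by blast
qed

text \<open>Mapping \<open>u\<close> to its neighbour \<open>z\<close> collapses the pendant edge and fixes every other edge, so it
  carries a walk to a walk that avoids \<open>u\<close>.\<close>

lemma edge_connected_remove_pendant:
  assumes "edge_connected (insert {u, z} B)" "u \<notin> \<Union>B"
  shows "edge_connected B"
  unfolding edge_connected_iff
proof (intro ballI)
  fix a b assume a: "a \<in> \<Union>B" and b: "b \<in> \<Union>B"
  define h where "h = (\<lambda>v. if v = u then z else v)"
  have "(a, b) \<in> (adj (insert {u, z} B))\<^sup>*"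
    using assms(1) a b unfolding edge_connected_iff by blast
  then have "(h a, h b) \<in> (adj B)\<^sup>*"
  proof (rule rtrancl_image)
    fix p q assume "(p, q) \<in> adj (insert {u, z} B)"
    then have "{p, q} = {u, z} \<or> {p, q} \<in> B" unfolding adj_def by auto
    then show "(h p, h q) \<in> (adj B)\<^sup>*"
    proof
      assume "{p, q} = {u, z}"
      then have "h p = h q" unfolding h_def by (auto simp: doubleton_eq_iff)
      then show ?thesis by simp
    next
      assume "{p, q} \<in> B"
      moreover from this have "h p = p" "h q = q" using assms(2) unfolding h_def by auto
      ultimately show ?thesis unfolding adj_def by auto
    qed
  qed
  moreover have "h a = a" "h b = b" using a b assms(2) unfolding h_def by auto
  ultimately show "(a, b) \<in> (adj B)\<^sup>*" by simp
qed

locale connected_simple_graph =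
  fixes G :: "'a graph"
  assumes simple: "simple_graph G" and connected: "connected_graph G"
begin

abbreviation "E \<equiv> edges G"

definition boundary :: "'a set set \<Rightarrow> 'a set" where
  "boundary X = \<Union>X \<inter> \<Union>(E - X)"

lemma edge_card: "e \<in> E \<Longrightarrow> card e = 2"
  using simple unfolding simple_graph_def by blast

lemma edge_verts: "e \<in> E \<Longrightarrow> e \<subseteq> verts G"
  using simple unfolding simple_graph_def by blast

lemma edge_nonempty: "e \<in> E \<Longrightarrow> e \<noteq> {}"
  using edge_card by fastforce

lemma edge_finite: "e \<in> E \<Longrightarrow> finite e"
  using edge_card by (metis card.infinite zero_neq_numeral)

lemma edge_distinct: "{a, b} \<in> E \<Longrightarrow> a \<noteq> b"
  using edge_card by fastforce

lemma edge_other_end: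
  assumes "e \<in> E" "a \<in> e"
  obtains b where "e = {a, b}" "b \<noteq> a"
  using edge_card[OF assms(1)] assms(2) by (auto simp: card_2_iff)

lemma Union_nonempty: "X \<subseteq> E \<Longrightarrow> X \<noteq> {} \<Longrightarrow> \<Union>X \<noteq> {}"
  using edge_nonempty by blast

lemma finite_boundary: "finite (boundary X)"
proof -
  have "boundary X \<subseteq> verts G" unfolding boundary_def using edge_verts by blast
  then show ?thesis using simple unfolding simple_graph_def by (blast intro: finite_subset)
qed

lemma boundaryI: "e \<in> X \<Longrightarrow> v \<in> e \<Longrightarrow> f \<in> E \<Longrightarrow> f \<notin> X \<Longrightarrow> v \<in> f \<Longrightarrow> v \<in> boundary X"
  unfolding boundary_def by blast

text \<open>The only place where the connectedness of the graph enters the combinatorics of boundaries: a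
  walk from a covered vertex to an edge outside \<open>X\<close> has to pass a boundary vertex.\<close>

lemma boundary_nonempty:
  assumes "X \<subseteq> E" "X \<noteq> {}" "X \<noteq> E"
  shows "boundary X \<noteq> {}"
proof
  assume emp: "boundary X = {}"
  obtain a where a: "a \<in> \<Union>X" using Union_nonempty assms by blast
  obtain f where f: "f \<in> E" "f \<notin> X" using assms by blast
  obtain b where b: "b \<in> f" using edge_nonempty f by blast
  have "(a, b) \<in> (adj E)\<^sup>*"
  proof -
    have "a \<in> verts G" "b \<in> verts G" using a b f edge_verts assms by blast+
    then show ?thesis using connected unfolding connected_graph_def adj_def by blast
  qed
  then have "b \<in> \<Union>X"
  proof (induction rule: rtrancl_induct)
    case base
    show ?case by (rule a)
  next
    case (step y z)
    then have "{y, z} \<in> E" unfolding adj_def by simp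
    then have "{y, z} \<in> X" using step.IH emp unfolding boundary_def by blast
    then show ?case by blast
  qed
  then show False using emp b f unfolding boundary_def by blast
qed

text \<open>A vertex of either boundary on the left is a boundary vertex of \<open>A\<close> or of \<open>B\<close>, and a vertex of
  both has edges in \<open>A \<inter> B\<close> and outside \<open>A \<union> B\<close>, so it counts twice on the right as well.\<close>

lemma boundary_submodular:
  "card (boundary (A \<union> B)) + card (boundary (A \<inter> B)) \<le> card (boundary A) + card (boundary B)"
proof -
  have "card (boundary (A \<union> B)) + card (boundary (A \<inter> B))
      = card (boundary (A \<union> B) \<union> boundary (A \<inter> B)) + card (boundary (A \<union> B) \<inter> boundary (A \<inter> B))"
    by (rule card_Un_Int) (rule finite_boundary)+
  also have "\<dots> \<le> card (boundary A \<union> boundary B) + card (boundary A \<inter> boundary B)"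
    by (intro add_mono card_mono) (auto simp: finite_boundary, auto simp: boundary_def)
  also have "\<dots> = card (boundary A) + card (boundary B)"
    by (rule card_Un_Int[symmetric]) (rule finite_boundary)+
  finally show ?thesis .
qed

lemma boundary_eq_singleton:
  assumes "card (boundary Y) \<le> 1" "a \<in> boundary Y"
  shows "boundary Y = {a}"
  using assms card_le_Suc0_iff_eq[OF finite_boundary, of Y] by auto

lemma boundary_insert: "boundary (insert e X) \<subseteq> boundary X \<union> e"
  unfolding boundary_def by blast

section \<open>Monotone expansions of connected edge sets\<close>

text \<open>The set whose size is bounded by two consists of the vertices that are occupied right after the
  move: the boundary of the new set, and an endpoint that has just been reached. The latter counts
  even if it is a leaf. Otherwise a pendant edge could be cleaned while both searchers are
  tied to other vertices.\<close>

definition edge_step :: "'a set set \<Rightarrow> 'a set set \<Rightarrow> bool" where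
  "edge_step X X' \<longleftrightarrow> edge_connected X' \<and> (\<exists>e\<in>E - X. X' = insert e X \<and>
     card (boundary (insert e X) \<union> (e - \<Union>X)) \<le> 2)"

text \<open>While \<open>w\<close> is guarded, the free searcher is placed on a leaf \<open>v\<close> and slides to its neighbour \<open>u\<close>,
  which cleans \<open>uv\<close> and \<open>uw\<close> at the same time. In general this is not a sequence of two edge steps: cleaning
  \<open>uv\<close> first disconnects the clean edges, and cleaning \<open>uw\<close> first may tie both searchers to \<open>u\<close> and \<open>w\<close>
  before the leaf is visited.\<close>

definition leaf_step :: "'a set set \<Rightarrow> 'a set set \<Rightarrow> bool" where
  "leaf_step X X' \<longleftrightarrow> edge_connected X' \<and> (\<exists>u v w. X' = X \<union> {{u, w}, {u, v}} \<and>
     {u, w} \<in> E \<and> {u, v} \<in> E \<and> boundary X = {w} \<and> u \<notin> \<Union>X \<and>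
     (\<forall>f\<in>E. v \<in> f \<longrightarrow> f = {u, v}))"

lemma edge_stepI:
  assumes "e \<in> E" "e \<notin> X" "edge_connected (insert e X)"
    "card (boundary (insert e X) \<union> (e - \<Union>X)) \<le> 2"
  shows "edge_step X (insert e X)"
  unfolding edge_step_def by (intro conjI bexI[of _ e] refl assms) (simp add: assms)

lemma leaf_stepI:
  assumes "edge_connected (X \<union> {{u, w}, {u, v}})" "{u, w} \<in> E" "{u, v} \<in> E" "boundary X = {w}"
    "u \<notin> \<Union>X" "\<forall>f\<in>E. v \<in> f \<longrightarrow> f = {u, v}"
  shows "leaf_step X (X \<union> {{u, w}, {u, v}})"
  unfolding leaf_step_def by (intro conjI exI) (rule assms refl)+

inductive expansion :: "'a set set \<Rightarrow> bool" where
  empty: "expansion {}"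
| edge: "expansion X \<Longrightarrow> edge_step X X' \<Longrightarrow> expansion X'"
| leaf: "expansion X \<Longrightarrow> leaf_step X X' \<Longrightarrow> expansion X'"

lemma expansion_subset: "expansion X \<Longrightarrow> X \<subseteq> E"
  by (induction rule: expansion.induct) (auto simp: edge_step_def leaf_step_def)

lemma expansion_connected: "expansion X \<Longrightarrow> edge_connected X"
proof (cases rule: expansion.cases)
  assume "expansion X" "X = {}"
  then show ?thesis unfolding edge_connected_iff by simp
qed (auto simp: edge_step_def leaf_step_def)

lemma expansion_boundary: "expansion X \<Longrightarrow> card (boundary X) \<le> 2"
proof (induction rule: expansion.induct)
  case empty
  show ?case by (simp add: boundary_def)
next
  case (edge X X')
  then obtain e where e: "X' = insert e X" "e \<in> E" "card (boundary (insert e X) \<union> (e - \<Union>X)) \<le> 2"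
    unfolding edge_step_def by blast
  have "card (boundary X') \<le> card (boundary (insert e X) \<union> (e - \<Union>X))"
    unfolding e(1) by (intro card_mono) (auto simp: finite_boundary edge_finite e)
  then show ?case using e by linarith
next
  case (leaf X X')
  then obtain u v w where s: "X' = X \<union> {{u, w}, {u, v}}" "{u, v} \<in> E" "boundary X = {w}"
     "\<forall>f\<in>E. v \<in> f \<longrightarrow> f = {u, v}"
    unfolding leaf_step_def by blast
  have "boundary X' \<subseteq> {w, u}"
    using s unfolding boundary_def by blast
  then have "card (boundary X') \<le> card {w, u}" by (intro card_mono) auto
  also have "\<dots> \<le> 2" by (simp add: card_insert_if)
  finally show ?case .
qed

text \<open>With at most one guard the other searcher is free, so any adjacent edge can be added: both of
  its endpoints are occupied after the move, and nothing else needs a guard.\<close>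

lemma edge_step_small_boundary:
  assumes "card (boundary Y) \<le> 1" "e \<in> E" "e \<notin> Y" "Y \<subseteq> E" "edge_connected (insert e Y)"
  shows "edge_step Y (insert e Y)"
proof -
  have "boundary (insert e Y) \<union> (e - \<Union>Y) \<subseteq> e"
  proof (cases "Y = {}")
    case True
    then show ?thesis by (auto simp: boundary_def)
  next
    case False
    have "\<Union>{e} \<inter> \<Union>Y \<noteq> {}"
      by (rule edge_connected_meet) (use assms False Union_nonempty edge_nonempty in auto)
    then obtain a where a: "a \<in> e" "a \<in> \<Union>Y" by blast
    then have "a \<in> boundary Y" unfolding boundary_def using assms by blast
    then have "boundary Y = {a}" using boundary_eq_singleton assms(1) by blast
    then show ?thesis using boundary_insert[of e Y] a by auto
  qed
  then have "card (boundary (insert e Y) \<union> (e - \<Union>Y)) \<le> card e"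
    by (intro card_mono edge_finite assms)
  then show ?thesis using assms edge_card unfolding edge_step_def by auto
qed

lemma edge_step_first: "{u, v} \<in> E \<Longrightarrow> edge_step {} {{u, v}}"
  by (rule edge_step_small_boundary) (simp_all add: boundary_def edge_connected_single)

text \<open>An edge outside \<open>X\<close> meets \<open>X\<close> at most in \<open>x\<close>. Sending all vertices not covered by \<open>X\<close> to \<open>x\<close> therefore
  collapses these edges, and maps walks in \<open>Y\<close> to walks in \<open>Y \<inter> X\<close>.\<close>

lemma edge_connected_restrict:
  assumes "edge_connected Y" "Y \<subseteq> E" "boundary X = {x}"
  shows "edge_connected (Y \<inter> X)"
  unfolding edge_connected_iff
proof (intro ballI)
  fix a b assume a: "a \<in> \<Union>(Y \<inter> X)" and b: "b \<in> \<Union>(Y \<inter> X)"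
  define h where "h = (\<lambda>v. if v \<in> \<Union>X then v else x)"
  have "(a, b) \<in> (adj Y)\<^sup>*" using assms(1) a b unfolding edge_connected_iff by blast
  then have "(h a, h b) \<in> (adj (Y \<inter> X))\<^sup>*"
  proof (rule rtrancl_image)
    fix p q assume "(p, q) \<in> adj Y"
    then have pq: "{p, q} \<in> Y" unfolding adj_def by auto
    show "(h p, h q) \<in> (adj (Y \<inter> X))\<^sup>*"
    proof (cases "{p, q} \<in> X")
      case True
      then have "h p = p" "h q = q" unfolding h_def by auto
      then show ?thesis using True pq unfolding adj_def by auto
    next
      case False
      then have "p \<notin> \<Union>X \<or> p = x" "q \<notin> \<Union>X \<or> q = x"
        using pq assms unfolding boundary_def by blast+
      then have "h p = h q" unfolding h_def by auto
      then show ?thesis by simp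
    qed
  qed
  moreover have "h a = a" "h b = b" using a b unfolding h_def by auto
  ultimately show "(a, b) \<in> (adj (Y \<inter> X))\<^sup>*" by simp
qed

text \<open>A vertex of \<open>X\<close> other than \<open>x\<close> has all its edges in \<open>X\<close>, so it needs a guard for \<open>Y \<inter> X\<close> only if it
  needs one for \<open>Y\<close>. The vertex \<open>x\<close> may need a new one, if \<open>Y\<close> has already cleaned all edges at \<open>x\<close>. In that case
  \<open>X \<union> Y'\<close> has a boundary vertex outside \<open>X\<close>, whose guard is no longer needed and can stand
  on \<open>x\<close> instead.\<close>

lemma edge_step_restrict:
  assumes "edge_step Y Y'" "Y' \<subseteq> E" "X \<subseteq> E" "boundary X = {x}" "X \<union> Y' \<noteq> E"
  shows "Y' \<inter> X = Y \<inter> X \<or> edge_step (Y \<inter> X) (Y' \<inter> X)"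
proof -
  obtain e where e: "e \<in> E" "e \<notin> Y" "Y' = insert e Y" "card (boundary Y' \<union> (e - \<Union>Y)) \<le> 2"
    and cn: "edge_connected Y'"
    using assms(1) unfolding edge_step_def by auto
  show ?thesis
  proof (cases "e \<in> X")
    case False
    then show ?thesis using e by auto
  next
    case True
    define Z where "Z = Y \<inter> X"
    have Z': "Y' \<inter> X = insert e Z" using e True Z_def by auto
    define L where "L = boundary (insert e Z) \<union> (e - \<Union>Z)"
    define R where "R = boundary Y' \<union> (e - \<Union>Y)"
    have pure: "f \<in> X" if "v \<in> \<Union>X" "v \<noteq> x" "f \<in> E" "v \<in> f" for v f
      using that assms(4) unfolding boundary_def by blast
    have "L \<subseteq> \<Union>(insert e Z)" unfolding L_def boundary_def by blast
    then have LX: "L \<subseteq> \<Union>X" and LY: "L \<subseteq> \<Union>Y'" using Z' by auto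
    have LR: "v \<in> R" if "v \<in> L" "v \<noteq> x" for v
    proof -
      have all: "f \<in> X" if "f \<in> E" "v \<in> f" for f
        using pure[of v f] that LX \<open>v \<in> L\<close> \<open>v \<noteq> x\<close> by blast
      consider "v \<in> boundary (insert e Z)" | "v \<in> e" "v \<notin> \<Union>Z"
        using \<open>v \<in> L\<close> unfolding L_def by blast
      then show ?thesis
      proof cases
        case 1
        then obtain f where "f \<in> E" "f \<notin> insert e Z" "v \<in> f" unfolding boundary_def by blast
        then have "f \<in> E - Y'" "v \<in> f" using all[of f] Z' by auto
        then show ?thesis using LY that(1) unfolding R_def boundary_def by blast
      next
        case 2
        have "v \<notin> \<Union>Y"
        proof
          assume "v \<in> \<Union>Y"
          then obtain g where g: "g \<in> Y" "v \<in> g" by blast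
          then have "g \<in> Z" using all[of g] assms(2) e Z_def by auto
          then show False using 2 g by blast
        qed
        then show ?thesis using 2 unfolding R_def by blast
      qed
    qed
    have finR: "finite R" unfolding R_def using finite_boundary edge_finite e by simp
    have "card L \<le> card R"
    proof (cases "x \<in> L \<and> x \<notin> R")
      case False
      then have "L \<subseteq> R" using LR by blast
      then show ?thesis using finR by (intro card_mono)
    next
      case x: True
      have xall: "f \<in> Y'" if "f \<in> E" "x \<in> f" for f
        using x that LY unfolding R_def boundary_def by blast
      \<comment> \<open>the guard \<open>p\<close> outside \<open>X\<close> that is exchanged for \<open>x\<close>\<close>
      have "boundary (X \<union> Y') \<noteq> {}"
        using assms True by (intro boundary_nonempty) auto
      then obtain p f g where p: "p \<in> g" "g \<in> X \<union> Y'" "p \<in> f" "f \<in> E" "f \<notin> X" "f \<notin> Y'"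
        unfolding boundary_def by blast
      have "p \<notin> \<Union>X" using pure[of p f] xall[of f] p by blast
      then have "p \<in> R" "p \<notin> L" using p LX unfolding R_def boundary_def by blast+
      then have "L \<subseteq> insert x (R - {p})" using LR by blast
      then have "card L \<le> card (insert x (R - {p}))" using finR by (intro card_mono) auto
      also have "\<dots> = card R" using x \<open>p \<in> R\<close> finR card_Suc_Diff1[of R p] by simp
      finally show ?thesis .
    qed
    then have "card L \<le> 2" using e R_def by simp
    moreover have "edge_connected (insert e Z)"
      using edge_connected_restrict[OF cn assms(2,4)] Z' by simp
    ultimately have "edge_step Z (insert e Z)"
      unfolding edge_step_def L_def using e Z_def by auto
    then show ?thesis using Z' Z_def by simp
  qed
qed

text \<open>All stages of the expansion \<open>Y\<close> are intersected with \<open>X\<close>. An edge step stays an edge step or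
  becomes void. A leaf step can lose one of its two edges, and it is replaced by two edge steps if
  it becomes the first step inside \<open>X\<close>; submodularity leaves at most one guard before it, so these edge steps
  are affordable.\<close>

lemma expansion_restrict:
  assumes "expansion Y" "X \<subseteq> E" "boundary X = {x}" "X \<union> Y \<noteq> E"
  shows "expansion (Y \<inter> X)"
  using assms(1,4)
proof (induction rule: expansion.induct)
  case empty
  show ?case using expansion.empty by simp
next
  case (edge Y Y')
  have "Y' \<subseteq> E" using expansion_subset expansion.edge edge by blast
  moreover have "Y \<subseteq> Y'" using edge unfolding edge_step_def by auto
  moreover from this have "expansion (Y \<inter> X)" using edge.IH edge.prems \<open>Y' \<subseteq> E\<close> assms(2) by blast
  ultimately show ?case using edge_step_restrict[of Y Y' X x] edge assms expansion.edge by metis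
next
  case (leaf Y Y')
  have Y'E: "Y' \<subseteq> E" using expansion_subset expansion.leaf leaf by blast
  obtain u v w where s: "Y' = Y \<union> {{u, w}, {u, v}}" "{u, w} \<in> E" "{u, v} \<in> E" "boundary Y = {w}"
     "u \<notin> \<Union>Y" "\<forall>f\<in>E. v \<in> f \<longrightarrow> f = {u, v}" and cn: "edge_connected Y'"
    using leaf unfolding leaf_step_def by blast
  have vY: "v \<notin> \<Union>Y" using s Y'E by blast
  define Z where "Z = Y \<inter> X"
  have ZE: "Z \<subseteq> E" using Z_def assms by blast
  have "Y \<subseteq> Y'" using s(1) by blast
  then have XY: "X \<union> Y \<noteq> E" "Y \<subseteq> E" using leaf.prems Y'E assms(2) by auto
  then have expZ: "expansion Z" using leaf.IH unfolding Z_def by blast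
  have cnZ: "edge_connected (Y' \<inter> X)" using edge_connected_restrict[OF cn Y'E assms(3)] .
  have "boundary (Y \<union> X) \<noteq> {}"
  proof (rule boundary_nonempty)
    show "Y \<union> X \<subseteq> E" "Y \<union> X \<noteq> E" using XY assms(2) by auto
    show "Y \<union> X \<noteq> {}" using s(4) unfolding boundary_def by auto
  qed
  then have "card (boundary (Y \<union> X)) \<ge> 1" using finite_boundary by (simp add: Suc_leI card_gt_0_iff)
  then have bZ: "card (boundary Z) \<le> 1"
    using boundary_submodular[of Y X] s(4) assms(3) unfolding Z_def by simp
  have unew: "{u, w} \<notin> Z" "{u, v} \<notin> Z" using s unfolding Z_def by blast+
  have add: "expansion (insert e Z)" if "e \<in> E" "e \<notin> Z" "edge_connected (insert e Z)" for e
    using edge_step_small_boundary[OF bZ that(1,2) ZE that(3)] expansion.edge[OF expZ] by blast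
  consider "{u, w} \<in> X" "{u, v} \<in> X" | "{u, w} \<in> X" "{u, v} \<notin> X"
    | "{u, w} \<notin> X" "{u, v} \<in> X" | "{u, w} \<notin> X" "{u, v} \<notin> X" by blast
  then show ?case
  proof cases
    case 1
    then have Z': "Y' \<inter> X = Z \<union> {{u, w}, {u, v}}" using s(1) Z_def by blast
    show ?thesis
    proof (cases "Z = {}")
      case True
      have "edge_step {} {{u, v}}"
        using edge_step_first s(3) by blast
      then have e1: "expansion {{u, v}}" using expansion.empty expansion.edge by blast
      show ?thesis
      proof (cases "{u, w} = {u, v}")
        case True
        then show ?thesis using e1 Z' \<open>Z = {}\<close> by simp
      next
        case False
        have "boundary {{u, v}} \<subseteq> {u}" using s(6) unfolding boundary_def by blast
        then have "card (boundary {{u, v}}) \<le> 1" using card_mono[of "{u}"] by fastforce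
        moreover have "edge_connected (insert {u, w} {{u, v}})" using cnZ Z' \<open>Z = {}\<close> by simp
        ultimately have "edge_step {{u, v}} (insert {u, w} {{u, v}})"
          using False s(2,3) by (intro edge_step_small_boundary) simp_all
        then show ?thesis using expansion.edge e1 Z' \<open>Z = {}\<close> by simp
      qed
    next
      case False
      have "\<Union>{{u, w}, {u, v}} \<inter> \<Union>Z \<noteq> {}"
      proof (rule edge_connected_meet)
        show "edge_connected ({{u, w}, {u, v}} \<union> Z)" using cnZ Z' by (simp add: Un_commute)
        show "\<Union>Z \<noteq> {}" using False ZE Union_nonempty by blast
      qed simp
      then have "w \<in> \<Union>Z" using s vY unfolding Z_def by blast
      then have "w \<in> boundary Z" using s unew unfolding boundary_def by blast
      then have bw: "boundary Z = {w}" using boundary_eq_singleton bZ by blast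
      have "u \<notin> \<Union>Z" using s(5) Z_def by auto
      then have "leaf_step Z (Y' \<inter> X)"
        using leaf_stepI[OF cnZ[unfolded Z'] s(2,3) bw _ s(6)] unfolding Z' by blast
      then show ?thesis using expansion.leaf expZ by blast
    qed
  next
    case 2
    then have Z': "Y' \<inter> X = insert {u, w} Z" using s(1) Z_def by auto
    then show ?thesis using add[of "{u, w}"] s(2) unew cnZ by simp
  next
    case 3
    then have Z': "Y' \<inter> X = insert {u, v} Z" using s(1) Z_def by auto
    then show ?thesis using add[of "{u, v}"] s(3) unew cnZ by simp
  next
    case 4
    then have "Y' \<inter> X = Z" using s(1) Z_def by auto
    then show ?thesis using expZ by simp
  qed
qed

section \<open>Edge sets dominated by expansions\<close>

text \<open>The bound on the boundary of \<open>Y\<close> ensures that whatever searchers are free for \<open>X\<close> are also free for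
  \<open>Y\<close>, so that the next step from \<open>X\<close> can be copied.\<close>

definition dominated :: "'a set set \<Rightarrow> bool" where
  "dominated X \<longleftrightarrow>
     (\<exists>Y. expansion Y \<and> X \<subseteq> Y \<and> card (boundary Y) \<le> card (boundary X))"

lemma expansion_dominated: "expansion X \<Longrightarrow> dominated X"
  unfolding dominated_def by blast

text \<open>If \<open>Y\<close> itself has too large a boundary, then that of \<open>X\<close> is a single vertex: an empty boundary
  would force \<open>X\<close>, and with it \<open>Y\<close>, to consist of all edges. So \<open>X\<close> can be cut out of \<open>Y\<close>.\<close>

lemma dominated_below_expansion:
  assumes "expansion Y" "X \<subseteq> Y" "edge_connected X"
  shows "dominated X"
proof (cases "X = {} \<or> card (boundary Y) \<le> card (boundary X)")
  case True
  then show ?thesis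
  proof
    assume "X = {}"
    then show ?thesis using expansion_dominated[OF expansion.empty] by simp
  next
    assume "card (boundary Y) \<le> card (boundary X)"
    then show ?thesis using assms unfolding dominated_def by blast
  qed
next
  case False
  have XE: "X \<subseteq> E" using assms expansion_subset by blast
  have "Y \<noteq> E" using False by (auto simp: boundary_def)
  then have "X \<noteq> E" using assms expansion_subset by blast
  then have "boundary X \<noteq> {}" using boundary_nonempty XE False by blast
  moreover have "card (boundary X) \<le> 1" using False expansion_boundary[OF assms(1)] by linarith
  ultimately have "card (boundary X) = 1"
    using finite_boundary by (metis One_nat_def Suc_leI card_gt_0_iff le_antisym)
  then obtain x where x: "boundary X = {x}" by (auto simp: card_1_singleton_iff)
  have "expansion (Y \<inter> X)"
    using expansion_restrict[OF assms(1) XE x] assms(2) \<open>Y \<noteq> E\<close> by (simp add: Un_absorb1)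
  then show ?thesis using expansion_dominated assms(2) by (simp add: Int_absorb1)
qed

lemma dominated_subset:
  assumes "dominated X" "X' \<subseteq> X" "edge_connected X'"
  shows "dominated X'"
  using assms dominated_below_expansion unfolding dominated_def by blast

text \<open>The step is copied from \<open>X\<close> to \<open>Y\<close>. If \<open>Y\<close> has two boundary vertices, then so has \<open>X\<close>, and adding \<open>e\<close>
  to \<open>X\<close> either closes a gap between covered vertices or is a slide along the last dirty edge of
  some vertex \<open>a\<close>. In \<open>Y\<close> the edge \<open>e\<close> is then also the last dirty edge at \<open>a\<close>.\<close>

lemma dominated_edge_step:
  assumes "dominated X" "edge_step X X'" "X \<subseteq> E"
  shows "dominated X'"
proof (cases "X = {}")
  case True
  then show ?thesis using assms expansion.empty expansion.edge expansion_dominated by blast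
next
  case False
  then obtain Y where Y: "expansion Y" "X \<subseteq> Y" "card (boundary Y) \<le> card (boundary X)"
    using assms unfolding dominated_def by blast
  obtain e where e: "e \<in> E" "e \<notin> X" "X' = insert e X" "card (boundary X' \<union> (e - \<Union>X)) \<le> 2"
    and cn: "edge_connected X'"
    using assms(2) unfolding edge_step_def by auto
  have YE: "Y \<subseteq> E" using Y expansion_subset by blast
  show ?thesis
  proof (cases "e \<in> Y")
    case True
    then show ?thesis using dominated_below_expansion Y e cn by blast
  next
    case eY: False
    have cnY: "edge_connected (insert e Y)"
    proof -
      have "\<Union>X \<subseteq> \<Union>Y \<inter> \<Union>X'" using Y(2) e(3) by blast
      then have "\<Union>Y \<inter> \<Union>X' \<noteq> {}" using Union_nonempty[OF assms(3) False] by auto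
      then have "edge_connected (Y \<union> X')"
        using edge_connected_Un expansion_connected[OF Y(1)] cn by blast
      moreover have "Y \<union> X' = insert e Y" using Y e by blast
      ultimately show ?thesis by simp
    qed
    have "edge_step Y (insert e Y)"
    proof (cases "card (boundary Y) \<le> 1")
      case True
      then show ?thesis using edge_step_small_boundary e eY YE cnY by blast
    next
      case big: False
      have bY2: "card (boundary Y) \<le> 2" using expansion_boundary Y by blast
      have "\<Union>{e} \<inter> \<Union>X \<noteq> {}"
        by (rule edge_connected_meet) (use cn e assms False Union_nonempty edge_nonempty in auto)
      then obtain a where a: "a \<in> e" "a \<in> \<Union>X" by blast
      then obtain b where b: "e = {a, b}" "b \<noteq> a" using edge_other_end e by metis
      have abd: "a \<in> boundary Y" using a Y e eY unfolding boundary_def by blast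
      let ?R = "boundary (insert e Y) \<union> (e - \<Union>Y)"
      have "card ?R \<le> card (boundary Y)"
      proof (cases "b \<in> \<Union>X")
        case True
        then have "b \<in> boundary Y" using b Y e eY unfolding boundary_def by blast
        then have "?R \<subseteq> boundary Y" using abd boundary_insert[of e Y] b unfolding boundary_def by blast
        then show ?thesis using finite_boundary by (intro card_mono)
      next
        case bX: False
        \<comment> \<open>otherwise \<open>b\<close> and the two boundary vertices of \<open>X\<close> would all be occupied\<close>
        have "a \<notin> boundary X'"
        proof
          assume "a \<in> boundary X'"
          then have "insert b (boundary X) \<subseteq> boundary X' \<union> (e - \<Union>X)"
            using b bX e unfolding boundary_def by blast
          then have "card (insert b (boundary X)) \<le> card (boundary X' \<union> (e - \<Union>X))"
            using finite_boundary edge_finite e by (intro card_mono) auto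
          moreover have "b \<notin> boundary X" using bX unfolding boundary_def by blast
          ultimately show False using e big Y finite_boundary by simp
        qed
        then have "a \<notin> boundary (insert e Y)" using a Y e unfolding boundary_def by blast
        then have "?R \<subseteq> insert b (boundary Y - {a})"
          using boundary_insert[of e Y] b abd unfolding boundary_def by blast
        then have "card ?R \<le> card (insert b (boundary Y - {a}))"
          using finite_boundary by (intro card_mono) auto
        also have "\<dots> \<le> Suc (card (boundary Y - {a}))" by (simp add: card_insert_le_m1 card_insert_if)
        also have "\<dots> = card (boundary Y)" using abd finite_boundary by (rule card_Suc_Diff1[rotated])
        finally show ?thesis .
      qed
      then have "card ?R \<le> 2" using bY2 by linarith
      then show ?thesis using edge_stepI[OF e(1) eY cnY] by blast
    qed
    then have "expansion (insert e Y)" using Y expansion.edge by blast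
    moreover have "card (boundary (insert e Y)) \<le> card (boundary X')"
    proof -
      have "Y \<union> X' = insert e Y" "Y \<inter> X' = X" using Y e eY by auto
      then show ?thesis using boundary_submodular[of Y X'] Y by simp
    qed
    ultimately show ?thesis unfolding dominated_def using Y e by blast
  qed
qed

text \<open>Since \<open>X\<close> has the single boundary vertex \<open>w\<close>, the boundary of \<open>Y\<close> has at most one vertex. This leaves
  few cases: \<open>Y\<close> contains both new edges; or it contains \<open>uw\<close> and the leaf edge is added with the free
  searcher; or it contains none of them, and then \<open>w\<close> is the boundary of \<open>Y\<close> and the leaf step itself
  is available.\<close>

lemma dominated_leaf_step:
  assumes "dominated X" "leaf_step X X'" "X \<subseteq> E"
  shows "dominated X'"
proof -
  obtain u v w where s: "X' = X \<union> {{u, w}, {u, v}}" "{u, w} \<in> E" "{u, v} \<in> E" "boundary X = {w}"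
     "u \<notin> \<Union>X" "\<forall>f\<in>E. v \<in> f \<longrightarrow> f = {u, v}" and cn: "edge_connected X'"
    using assms unfolding leaf_step_def by blast
  have Xne: "X \<noteq> {}" using s(4) by (auto simp: boundary_def)
  then obtain Y where Y: "expansion Y" "X \<subseteq> Y" "card (boundary Y) \<le> card (boundary X)"
    using assms unfolding dominated_def by blast
  have YE: "Y \<subseteq> E" using Y expansion_subset by blast
  show ?thesis
  proof (cases "X' \<subseteq> Y")
    case True
    then show ?thesis using dominated_below_expansion Y cn by blast
  next
    case notin: False
    have bY: "card (boundary Y) \<le> 1" using Y(3) s(4) by simp
    then have bY_eq: "p = q" if "p \<in> boundary Y" "q \<in> boundary Y" for p q
      using that boundary_eq_singleton by blast
    have uw: "u \<noteq> w" using s edge_distinct by blast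
    have wY: "w \<in> \<Union>Y" using s Y unfolding boundary_def by blast
    have "\<Union>X \<subseteq> \<Union>Y \<inter> \<Union>X'" using Y(2) s(1) by blast
    then have "\<Union>Y \<inter> \<Union>X' \<noteq> {}" using Union_nonempty[OF assms(3) Xne] by auto
    then have "edge_connected (Y \<union> X')"
      using edge_connected_Un expansion_connected[OF Y(1)] cn by blast
    moreover have "expansion (Y \<union> X')" if "edge_connected (Y \<union> X')"
    proof (cases "{u, w} \<in> Y")
      case True
      then have "{u, v} \<notin> Y" and eq: "Y \<union> X' = insert {u, v} Y" using notin s(1) Y(2) by auto
      then have "edge_step Y (insert {u, v} Y)"
        using edge_step_small_boundary[OF bY s(3)] YE that by simp
      then show ?thesis using expansion.edge Y eq by simp
    next
      case False
      then have wb: "w \<in> boundary Y" using wY s unfolding boundary_def by blast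
      then have wb': "boundary Y = {w}" using bY_eq by blast
      have "u \<notin> boundary Y" using bY_eq wb uw by blast
      then have uY: "u \<notin> \<Union>Y" using False s(2) unfolding boundary_def by blast
      have eq: "Y \<union> X' = Y \<union> {{u, w}, {u, v}}" using s(1) Y(2) by blast
      have "leaf_step Y (Y \<union> X')"
        using leaf_stepI[OF that[unfolded eq] s(2,3) wb' uY s(6)] unfolding eq .
      then show ?thesis using expansion.leaf Y by blast
    qed
    ultimately have "expansion (Y \<union> X')" by blast
    moreover have "card (boundary (Y \<union> X')) \<le> card (boundary X')"
    proof -
      have "Y \<noteq> E" using notin s(1-3) assms(3) by blast
      then have "boundary (Y \<inter> X') \<noteq> {}"
        using YE Xne Y(2) s(1) by (intro boundary_nonempty) auto
      then have "card (boundary (Y \<inter> X')) \<ge> 1" using finite_boundary by (simp add: Suc_leI card_gt_0_iff)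
      then show ?thesis using boundary_submodular[of Y X'] bY by linarith
    qed
    ultimately show ?thesis unfolding dominated_def by blast
  qed
qed


section \<open>Moves preserve domination\<close>

lemma card_set_mset_le_size: "card (set_mset M) \<le> size M"
  by (induction M) (auto simp: card_insert_if)

definition swept :: "'a multiset \<Rightarrow> 'a move \<Rightarrow> 'a set set" where
  "swept M m = {e \<in> E. e \<subseteq> set_mset (apply_move m M)} \<union> slid_edges m"

lemma swept_subset: "legal_move G M m \<Longrightarrow> swept M m \<subseteq> E"
  unfolding swept_def by (cases m) auto

text \<open>A move occupies at most one new vertex \<open>u\<close>. All edges between vertices occupied before are
  already clean, so an edge becomes clean only by joining \<open>u\<close> to such a vertex.\<close>

lemma swept_new_vertex:
  assumes "legal_move G M m" "\<forall>e\<in>E. e \<subseteq> set_mset M \<longrightarrow> e \<in> X" "e0 \<in> swept M m" "e0 \<notin> X"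
  obtains u where "u \<notin># M" "u \<in># apply_move m M" "set_mset (apply_move m M) \<subseteq> insert u (set_mset M)"
    "\<And>e. e \<in> swept M m \<Longrightarrow> e \<notin> X \<Longrightarrow> \<exists>z\<in>#M. e = {u, z}"
proof -
  have sE: "swept M m \<subseteq> E" using swept_subset assms(1) .
  obtain u where u: "set_mset (apply_move m M) \<subseteq> insert u (set_mset M)"
    "u \<in># apply_move m M \<or> u \<in># M" "\<And>e. e \<in> slid_edges m \<Longrightarrow> e \<subseteq> insert u (set_mset M)"
  proof (cases m)
    case (Place v)
    show ?thesis by (rule that[of v]) (use Place in auto)
  next
    case (Delete v)
    show ?thesis by (rule that[of v]) (use Delete assms(1) in \<open>auto dest: in_diffD\<close>)
  next
    case (Slide v u)
    show ?thesis by (rule that[of u]) (use Slide assms(1) in \<open>auto dest: in_diffD\<close>)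
  qed
  have sub: "e \<subseteq> insert u (set_mset M)" if "e \<in> swept M m" for e
    using that u unfolding swept_def by blast
  have uM: "u \<notin># M" using assms(2-4) sE sub[of e0] by auto
  have "\<exists>z\<in>#M. e = {u, z}" if e: "e \<in> swept M m" "e \<notin> X" for e
  proof -
    have "u \<in> e" using assms(2) e sE sub[of e] by auto
    then obtain z where "e = {u, z}" "z \<noteq> u" using edge_other_end[of e u] e sE by blast
    then show ?thesis using sub[of e] e by auto
  qed
  then show ?thesis using that uM u by blast
qed

text \<open>The set \<open>X'\<close> of clean edges after the move is compared with \<open>X\<close>. If it gains nothing, it is a
  subset. If it gains one edge, this edge is pendant, and \<open>X'\<close> without it is a connected subset of
  \<open>X\<close> from which an edge step leads to \<open>X'\<close>. If it gains two edges \<open>uv\<close> and \<open>uw\<close>, then a searcher slid from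
  \<open>v\<close> to \<open>u\<close> while the other one stayed at \<open>w\<close>. As \<open>v\<close> is left behind unguarded, all its edges must
  be clean, hence nothing is recontaminated and \<open>X'\<close> is \<open>X\<close> with the two edges. These are added by two
  edge steps, starting at \<open>v\<close>, unless \<open>v\<close> is not covered by a nonempty \<open>X\<close>; then \<open>v\<close> is a leaf and a leaf step
  applies.\<close>

lemma dominated_move:
  assumes dom: "dominated X" and XE: "X \<subseteq> E"
    and bX: "boundary X \<subseteq> set_mset M" and full: "\<forall>e\<in>E. e \<subseteq> set_mset M \<longrightarrow> e \<in> X"
    and legal: "legal_move G M m"
    and size: "size M \<le> 2" "size (apply_move m M) \<le> 2"
    and X'sub: "X' \<subseteq> X \<union> swept M m" and bX': "boundary X' \<subseteq> set_mset (apply_move m M)"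
    and keep: "boundary (X \<union> swept M m) \<subseteq> set_mset (apply_move m M) \<Longrightarrow> X' = X \<union> swept M m"
    and cnX: "edge_connected X" and cn: "edge_connected X'"
  shows "dominated X'"
proof (cases "X' \<subseteq> X")
  case True
  then show ?thesis using dominated_subset dom cn by blast
next
  case False
  define M' where "M' = apply_move m M"
  obtain e0 where e0: "e0 \<in> X'" "e0 \<notin> X" using False by blast
  have X'E: "X' \<subseteq> E" using X'sub XE swept_subset[OF legal] by blast
  obtain u where u: "u \<notin># M" "u \<in># M'" "set_mset M' \<subseteq> insert u (set_mset M)"
    and new: "\<And>e. e \<in> swept M m \<Longrightarrow> e \<notin> X \<Longrightarrow> \<exists>z\<in>#M. e = {u, z}"
    using swept_new_vertex[OF legal full _ e0(2)] e0 X'sub unfolding M'_def by blast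
  have new': "\<exists>z\<in>#M. e = {u, z}" if "e \<in> X'" "e \<notin> X" for e using new that X'sub by blast
  have uX: "u \<notin> \<Union>X"
  proof
    assume "u \<in> \<Union>X"
    then have "u \<in> boundary X" using new'[OF e0] e0 X'E unfolding boundary_def by blast
    then show False using bX u by blast
  qed
  have card_le: "card S \<le> 2" if "S \<subseteq> {p, q}" for S and p q :: 'a
    using card_mono[OF _ that] by (simp add: card_insert_if split: if_splits)
  have bM': "card (set_mset M') \<le> 2"
    using card_set_mset_le_size[of M'] size(2) unfolding M'_def by linarith
  show ?thesis
  proof (cases "\<exists>e. X' - X = {e}")
    case True
    then obtain z where z: "X' - X = {{u, z}}" "z \<in># M" using new' by blast
    \<comment> \<open>what survives of \<open>X\<close> after recontamination\<close>
    define B where "B = X' - {{u, z}}"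
    have X'B: "X' = insert {u, z} B" "{u, z} \<notin> B" and BX: "B \<subseteq> X" using z B_def by blast+
    have "u \<notin> \<Union>B" using uX BX by blast
    then have cnB: "edge_connected B" using edge_connected_remove_pendant cn X'B by metis
    then have domB: "dominated B" using dominated_subset dom BX by blast
    have uz: "{u, z} \<in> E" using X'B X'E by blast
    have "card (boundary (insert {u, z} B) \<union> ({u, z} - \<Union>B)) \<le> 2"
    proof (cases "B = {}")
      case True
      then show ?thesis by (intro card_le[of _ u z]) (auto simp: boundary_def)
    next
      case False
      have "\<Union>{{u, z}} \<inter> \<Union>B \<noteq> {}"
        by (rule edge_connected_meet) (use cn X'B Union_nonempty[of B] False X'E in auto)
      then have "z \<in> \<Union>B" using \<open>u \<notin> \<Union>B\<close> by blast
      then have "boundary (insert {u, z} B) \<union> ({u, z} - \<Union>B) \<subseteq> set_mset M'"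
        using bX' X'B u(2) M'_def by auto
      then show ?thesis using card_mono[of "set_mset M'"] bM' by (meson finite_set_mset le_trans)
    qed
    then have "edge_step B X'" using edge_stepI[OF uz X'B(2)] cn X'B(1) by simp
    then show ?thesis using dominated_edge_step domB X'E B_def by blast
  next
    case False
    then obtain e1 where e1: "e1 \<in> X'" "e1 \<notin> X" "e1 \<noteq> e0" using e0 by blast
    have "\<exists>v w. v \<noteq> w \<and> set_mset M = {v, w} \<and> set_mset M' = {u, w} \<and>
        {u, v} \<in> X' - X \<and> {u, w} \<in> X' - X"
    proof -
      obtain v w where vw: "v \<in># M" "w \<in># M" "e0 = {u, v}" "e1 = {u, w}" using new' e0 e1 by metis
      have "v \<noteq> w" using vw e1 by blast
      obtain M1 where M1: "M = add_mset v M1" using vw mset_add by metis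
      then have "w \<in># M1" using vw \<open>v \<noteq> w\<close> by simp
      then obtain M2 where M2: "M1 = add_mset w M2" using mset_add by metis
      then have M: "M = {#v, w#}" using size(1) M1 by simp
      show ?thesis
      proof (cases m)
        case (Place x)
        then show ?thesis using size(2) M by simp
      next
        case (Delete x)
        then show ?thesis using u M'_def by (auto dest: in_diffD)
      next
        case (Slide a x)
        then have "a = v \<or> a = w" using legal M by auto
        then show ?thesis
        proof
          assume "a = v"
          then have "M' = {#x, w#}" using Slide M M'_def by simp
          then have "set_mset M' = {u, w}" using u M by auto
          then show ?thesis using \<open>v \<noteq> w\<close> M vw e0 e1 by auto
        next
          assume "a = w"
          then have "M' = {#x, v#}" using Slide M M'_def by simp
          then have "set_mset M' = {u, v}" using u M by auto
          moreover have "set_mset M = {w, v}" using M by auto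
          moreover have "{u, w} \<in> X' - X" "{u, v} \<in> X' - X" using vw e0 e1 by auto
          ultimately show ?thesis using \<open>v \<noteq> w\<close> by metis
        qed
      qed
    qed
    then obtain v w where vw: "v \<noteq> w" "set_mset M = {v, w}" "set_mset M' = {u, w}"
      and ev: "{u, v} \<in> X'" "{u, v} \<notin> X" and ew: "{u, w} \<in> X'" "{u, w} \<notin> X" by blast
    have uv: "u \<noteq> v" "u \<noteq> w" using u vw by auto
    have "boundary X' \<subseteq> {u, w}" using bX' vw(3) M'_def by simp
    then have "v \<notin> boundary X'" using vw(1) uv by auto
    then have vall: "f \<in> X'" if "f \<in> E" "v \<in> f" for f
      using that ev(1) unfolding boundary_def by blast
    have bX2: "boundary X \<subseteq> {v, w}" using bX vw by simp
    have bX'2: "boundary X' \<subseteq> {u, w}" using bX' vw M'_def by simp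
    have QX: "X \<union> swept M m = X \<union> {{u, v}, {u, w}}"
    proof
      show "X \<union> swept M m \<subseteq> X \<union> {{u, v}, {u, w}}" using new vw(2) by auto
      show "X \<union> {{u, v}, {u, w}} \<subseteq> X \<union> swept M m" using X'sub ev ew by auto
    qed
    have "boundary (X \<union> {{u, v}, {u, w}}) \<subseteq> {u, w}"
    proof
      fix p assume p: "p \<in> boundary (X \<union> {{u, v}, {u, w}})"
      then obtain f where f: "f \<in> E" "p \<in> f" "f \<notin> X \<union> {{u, v}, {u, w}}" unfolding boundary_def by blast
      have "p \<noteq> v" using vall[of f] f X'sub QX by auto
      show "p \<in> {u, w}"
      proof (rule ccontr)
        assume "p \<notin> {u, w}"
        then have "p \<in> \<Union>X" using p \<open>p \<noteq> v\<close> unfolding boundary_def by auto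
        then have "p \<in> boundary X" using f unfolding boundary_def by blast
        then show False using bX2 \<open>p \<noteq> v\<close> \<open>p \<notin> {u, w}\<close> by blast
      qed
    qed
    then have X'eq: "X' = X \<union> {{u, w}, {u, v}}"
      using keep QX vw M'_def by (simp add: insert_commute)
    have step2: "edge_step (insert {u, v} X) X'" if "edge_connected (insert {u, v} X)"
    proof -
      have "X' = insert {u, w} (insert {u, v} X)" using X'eq by auto
      moreover have "{u, w} \<notin> insert {u, v} X" using ew vw(1) uv by (auto simp: doubleton_eq_iff)
      moreover have "card (boundary X' \<union> ({u, w} - \<Union>(insert {u, v} X))) \<le> 2"
        by (rule card_le[of _ u w]) (use bX'2 in blast)
      ultimately show ?thesis using edge_stepI[of "{u, w}" "insert {u, v} X"] ew X'E cn by auto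
    qed
    have uvE: "{u, v} \<in> E" and uwE: "{u, w} \<in> E" using ev ew X'E by blast+
    show ?thesis
    proof (cases "v \<in> \<Union>X \<or> X = {}")
      case True
      have step1: "edge_step X (insert {u, v} X)"
      proof (cases "X = {}")
        case True
        then show ?thesis using edge_step_first uvE by simp
      next
        case False
        then have vX: "v \<in> \<Union>X" using \<open>v \<in> \<Union>X \<or> X = {}\<close> by blast
        have "edge_connected ({{u, v}} \<union> X)"
          by (rule edge_connected_Un) (use edge_connected_single cnX vX in auto)
        moreover have "boundary (insert {u, v} X) \<union> ({u, v} - \<Union>X) \<subseteq> {u, w}"
        proof
          fix p assume p: "p \<in> boundary (insert {u, v} X) \<union> ({u, v} - \<Union>X)"
          show "p \<in> {u, w}"
          proof (rule ccontr)
            assume np: "p \<notin> {u, w}"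
            have "p \<in> boundary (insert {u, v} X)" using p np vX by blast
            then obtain g f where f: "g \<in> insert {u, v} X" "p \<in> g" "f \<in> E" "f \<notin> insert {u, v} X" "p \<in> f"
              unfolding boundary_def by blast
            have "f \<noteq> {u, w}" using f np by blast
            then have "f \<notin> X'" using f X'eq by simp
            then have "p \<in> boundary X'" using f X'eq unfolding boundary_def by blast
            then show False using bX'2 np by blast
          qed
        qed
        then have "card (boundary (insert {u, v} X) \<union> ({u, v} - \<Union>X)) \<le> 2" by (rule card_le)
        ultimately show ?thesis using edge_stepI[OF uvE ev(2)] by simp
      qed
      then have "dominated (insert {u, v} X)" using dominated_edge_step dom XE by blast
      moreover have "edge_connected (insert {u, v} X)" using step1 unfolding edge_step_def by blast
      ultimately show ?thesis using dominated_edge_step step2 XE uvE by blast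
    next
      case False
      have leaf: "\<forall>f\<in>E. v \<in> f \<longrightarrow> f = {u, v}"
      proof (intro ballI impI)
        fix f assume "f \<in> E" "v \<in> f"
        then have "f \<in> X'" "f \<notin> X" "f \<noteq> {u, w}" using vall False vw(1) uv by auto
        then show "f = {u, v}" using X'eq by simp
      qed
      have "\<Union>{{u, w}, {u, v}} \<inter> \<Union>X \<noteq> {}"
      proof (rule edge_connected_meet)
        show "edge_connected ({{u, w}, {u, v}} \<union> X)" using cn X'eq by (simp add: Un_commute)
        show "\<Union>X \<noteq> {}" using False XE Union_nonempty by blast
      qed simp
      then have "w \<in> \<Union>X" using uX False by blast
      then have "w \<in> boundary X" using uwE ew(2) unfolding boundary_def by blast
      moreover have "v \<notin> boundary X" using False unfolding boundary_def by blast
      ultimately have "boundary X = {w}" using bX2 by blast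
      then have "leaf_step X X'"
        using leaf_stepI[OF cn[unfolded X'eq] uwE uvE _ uX leaf] unfolding X'eq by blast
      then show ?thesis using dominated_leaf_step dom XE by blast
    qed
  qed
qed

section \<open>Recontamination and the guarded boundary\<close>

text \<open>An unoccupied vertex should never see both clean and dirty edges. This is not immediate, because
  recontamination spreads only along paths without repeated vertices. If \<open>y\<close> is occupied and the
  vertices \<open>x\<close> and \<open>d\<close> are connected through unoccupied ones, then a dirty edge \<open>dy\<close> does not reach a
  clean edge \<open>yx\<close>, as the two edges close a cycle at \<open>y\<close>. It has to be shown that a legal move never
  leads to such a cycle.\<close>

definition uncontaminated :: "'a set \<Rightarrow> 'a set set \<Rightarrow> 'a set set" where
  "uncontaminated occ Q = Q - {e. recontaminated G occ Q e}"

lemma clean_edges_Suc: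
  "clean_edges G S (Suc i) = uncontaminated (set_mset (searchers S (Suc i)))
     (clean_edges G S i \<union> swept (searchers S i) (S ! i))"
  unfolding uncontaminated_def by (simp add: cleaned_by_move_def swept_def Let_def)

lemma graph_path_successively:
  "graph_path G p \<longleftrightarrow> distinct p \<and> set p \<subseteq> verts G \<and> successively (\<lambda>a b. {a, b} \<in> E) p"
  unfolding graph_path_def successively_conv_nth by blast

text \<open>Along a recontaminating path from a clean edge \<open>e\<close>, the first change from clean to dirty happens at
  an inner vertex \<open>p ! j\<close> of the path.\<close>

lemma recontaminated_boundary:
  assumes "recontaminated G occ Q e" "e \<in> Q"
  obtains p j where "graph_path G p" "e = {p ! 0, p ! 1}" "0 < j" "Suc j < length p"
    "\<forall>i. 0 < i \<and> i \<le> j \<longrightarrow> p ! i \<notin> occ" "p ! j \<in> boundary Q"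
proof -
  obtain p where p: "graph_path G p" "length p \<ge> 2" "{p ! 0, p ! 1} = e"
    "{p ! (length p - 2), p ! (length p - 1)} \<notin> Q"
    "\<And>j. 0 < j \<Longrightarrow> j < length p - 1 \<Longrightarrow> p ! j \<notin> occ"
    using assms(1) unfolding recontaminated_def by auto
  define dirty where "dirty = (\<lambda>k. Suc k < length p \<and> {p ! k, p ! Suc k} \<notin> Q)"
  have "Suc (length p - 2) = length p - 1" using p(2) by simp
  then have ex: "dirty (length p - 2)" using p(2,4) unfolding dirty_def by simp
  define j where "j = (LEAST k. dirty k)"
  have j: "dirty j" unfolding j_def using ex by (rule LeastI)
  have "\<not> dirty 0" using assms(2) p(3) unfolding dirty_def by simp
  then have j0: "0 < j" using j by (metis gr0I)
  then have "\<not> dirty (j - 1)" unfolding j_def by (intro not_less_Least) (simp add: j_def[symmetric])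
  then have "{p ! (j - 1), p ! j} \<in> Q" using j j0 unfolding dirty_def by simp
  moreover have "{p ! j, p ! Suc j} \<in> E" using p(1) j unfolding graph_path_def dirty_def by blast
  ultimately have "p ! j \<in> boundary Q" using j unfolding dirty_def by (intro boundaryI) auto
  moreover have "\<forall>i. 0 < i \<and> i \<le> j \<longrightarrow> p ! i \<notin> occ" using p(5) j unfolding dirty_def by auto
  ultimately show ?thesis using that[of p j] p(1,3) j j0 unfolding dirty_def by blast
qed

lemma uncontaminated_all:
  assumes "boundary Q \<subseteq> occ"
  shows "uncontaminated occ Q = Q"
proof -
  have "\<not> recontaminated G occ Q e" if e: "e \<in> Q" for e
  proof
    assume "recontaminated G occ Q e"
    then obtain p j where "graph_path G p" "e = {p ! 0, p ! 1}" "0 < j" "Suc j < length p"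
      "\<forall>i. 0 < i \<and> i \<le> j \<longrightarrow> p ! i \<notin> occ" "p ! j \<in> boundary Q"
      by (rule recontaminated_boundary[OF _ e])
    then show False using assms by blast
  qed
  then show ?thesis unfolding uncontaminated_def by blast
qed

lemma uncontaminated_guarded:
  assumes "e \<in> Q" "e \<subseteq> occ"
  shows "e \<in> uncontaminated occ Q"
proof -
  have "\<not> recontaminated G occ Q e"
  proof
    assume "recontaminated G occ Q e"
    then obtain p j where "e = {p ! 0, p ! 1}" "0 < j" "\<forall>i. 0 < i \<and> i \<le> j \<longrightarrow> p ! i \<notin> occ"
      using recontaminated_boundary assms(1) by blast
    then have "p ! 1 \<in> e" "p ! 1 \<notin> occ" by auto
    then show False using assms(2) by blast
  qed
  then show ?thesis unfolding uncontaminated_def using assms(1) by blast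
qed

text \<open>The part of \<open>p\<close> that ends with the dirty edge recontaminates the first edge. The last vertex of \<open>p\<close> may
  be occupied, as it is not an inner vertex of this part.\<close>

lemma recontaminated_if_dirty_on_path:
  assumes p: "graph_path G p" "\<And>v. v \<in> set (tl p) \<Longrightarrow> v \<notin> occ \<or> v = last p"
    and k: "Suc k < length p" "{p ! k, p ! Suc k} \<notin> Q"
  shows "recontaminated G occ Q {p ! 0, p ! 1}"
proof -
  define q where "q = take (k + 2) p"
  have len: "length q = k + 2" using k q_def by simp
  have nth: "q ! i = p ! i" if "i < k + 2" for i using that q_def by simp
  have "graph_path G q"
    using p(1) k unfolding graph_path_def q_def by (auto dest: in_set_takeD)
  moreover have "p ! j \<notin> occ" if "0 < j" "j < k + 1" for j
  proof -
    have "j < length p" using that k by simp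
    then have "p ! j \<in> set (tl p)" using that(1) using nth_mem[of "j - 1" "tl p"] by (simp add: nth_tl)
    moreover have "p ! j \<noteq> last p"
    proof -
      have "p \<noteq> []" using k by auto
      then show ?thesis using p(1) that k unfolding graph_path_def
        by (simp add: last_conv_nth nth_eq_iff_index_eq)
    qed
    ultimately show ?thesis using p(2) by blast
  qed
  ultimately show ?thesis
    unfolding recontaminated_def using k len nth by (intro exI[of _ q]) auto
qed

text \<open>Recontamination asks for paths without repeated vertices, so a walk through unoccupied vertices
  has to be shortened: when a vertex comes up again, the path is restarted from it.\<close>

lemma free_path:
  assumes "(x, c) \<in> {(p, q). {p, q} \<in> E \<and> p \<notin> occ \<and> q \<notin> occ}\<^sup>*" "c \<notin> occ" "c \<in> verts G"
  shows "\<exists>q. graph_path G q \<and> q \<noteq> [] \<and> hd q = x \<and> last q = c \<and> set q \<inter> occ = {}"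
  using assms(1)
proof (induction rule: converse_rtrancl_induct)
  case base
  show ?case by (rule exI[of _ "[c]"]) (use assms in \<open>auto simp: graph_path_def\<close>)
next
  case (step x y)
  then obtain q where q: "graph_path G q" "q \<noteq> []" "hd q = y" "last q = c" "set q \<inter> occ = {}" by blast
  show ?case
  proof (cases "x \<in> set q")
    case True
    then obtain as bs where "q = as @ x # bs" by (meson split_list)
    then show ?thesis using q
      by (intro exI[of _ "x # bs"]) (auto simp: graph_path_successively successively_append_iff)
  next
    case False
    have "x \<in> verts G" using step edge_verts by blast
    then show ?thesis using q step False
      by (intro exI[of _ "x # q"]) (auto simp: graph_path_successively successively_Cons)
  qed
qed

text \<open>If \<open>c\<close> is the only unoccupied vertex that sees both clean and dirty edges, exactly those clean edges are
  lost that meet the set of vertices connected to \<open>c\<close> through unoccupied vertices. So the unoccupied vertices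
  in this set see only dirty edges afterwards, and the others are as before.

  The hypothesis on edges from \<open>c\<close> to occupied vertices is what excludes the cycles mentioned above. A path that leads
  to \<open>c\<close> is to be prolonged by a dirty edge \<open>cd\<close>, and fails to remain a path if \<open>d\<close> is on it.
  Since \<open>d\<close> is unoccupied, it sees only dirty edges, and so the path contains a dirty edge anyway.\<close>

lemma boundary_uncontaminated:
  assumes QE: "Q \<subseteq> E" and c: "c \<notin> occ" and bQ: "boundary Q \<subseteq> insert c occ"
    and cd: "\<And>d. d \<in> occ \<Longrightarrow> {c, d} \<in> E \<Longrightarrow> {c, d} \<in> Q"
  shows "boundary (uncontaminated occ Q) \<subseteq> occ"
proof (cases "c \<in> boundary Q")
  case False
  then have "boundary Q \<subseteq> occ" using bQ by blast
  then show ?thesis using uncontaminated_all by simp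
next
  case True
  then obtain f0 where f0: "f0 \<in> E" "c \<in> f0" "f0 \<notin> Q" unfolding boundary_def by blast
  then obtain d where d: "f0 = {c, d}" "d \<noteq> c" using edge_other_end by blast
  have docc: "d \<notin> occ" using cd f0 d by blast
  have cV: "c \<in> verts G" and dV: "d \<in> verts G" using f0 d edge_verts by blast+
  define free where "free = {(p, q). {p, q} \<in> E \<and> p \<notin> occ \<and> q \<notin> occ}"
  have path_rec: "recontaminated G occ Q {p ! 0, p ! 1}"
    if p: "graph_path G p" "length p \<ge> 2" "last p = c" "\<And>v. v \<in> set (tl p) \<Longrightarrow> v \<notin> occ" for p
  proof (cases "\<exists>k. Suc k < length p \<and> {p ! k, p ! Suc k} \<notin> Q")
    case True
    then show ?thesis using recontaminated_if_dirty_on_path p by blast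
  next
    case allQ: False
    have pne: "p \<noteq> []" using p(2) by auto
    have "d \<notin> set p"
    proof
      assume "d \<in> set p"
      then obtain k where k: "k < length p" "p ! k = d" by (meson in_set_conv_nth)
      then have "k \<noteq> length p - 1" using p(3) d(2) pne by (auto simp: last_conv_nth)
      then have "{d, p ! Suc k} \<in> Q" using k allQ by (metis Suc_lessI diff_Suc_1)
      then have "d \<in> boundary Q" using f0 d unfolding boundary_def by blast
      then show False using bQ docc d by blast
    qed
    then have "graph_path G (p @ [d])"
      using p(1,3) dV f0 d pne by (auto simp: graph_path_successively successively_append_iff)
    moreover have "v \<notin> occ \<or> v = last (p @ [d])" if "v \<in> set (tl (p @ [d]))" for v
      using that p(4) pne by auto
    moreover have "Suc (length p - 1) < length (p @ [d])" using pne by simp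
    moreover have "(p @ [d]) ! (length p - 1) = c" "(p @ [d]) ! Suc (length p - 1) = d"
      using pne p(3) by (auto simp: nth_append last_conv_nth)
    moreover have "(p @ [d]) ! 0 = p ! 0" "(p @ [d]) ! 1 = p ! 1" using p(2) by (auto simp: nth_append)
    ultimately show ?thesis
      using recontaminated_if_dirty_on_path[of "p @ [d]" occ "length p - 1" Q] f0 d by auto
  qed
  have touch_rec: "recontaminated G occ Q f" if f: "f \<in> Q" "x \<in> f" and x: "(x, c) \<in> free\<^sup>*" "x \<notin> occ" for f x
  proof -
    obtain y where y: "f = {x, y}" "y \<noteq> x" using edge_other_end f QE by blast
    have yV: "y \<in> verts G" and fE: "{x, y} \<in> E" using y f QE edge_verts by blast+
    obtain q where q: "graph_path G q" "q \<noteq> []" "hd q = x" "last q = c" "set q \<inter> occ = {}"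
      using free_path x c cV unfolding free_def by blast
    show ?thesis
    proof (cases "y \<in> set q")
      case False
      have "graph_path G (y # q)"
        using False q yV fE by (auto simp: graph_path_successively successively_Cons insert_commute)
      moreover have "length (y # q) \<ge> 2" "last (y # q) = c" using q by (auto simp: Suc_le_eq)
      moreover have "v \<notin> occ" if "v \<in> set (tl (y # q))" for v using that q by auto
      ultimately have "recontaminated G occ Q {(y # q) ! 0, (y # q) ! 1}" by (rule path_rec)
      then show ?thesis using y q(2,3) by (simp add: hd_conv_nth insert_commute)
    next
      case True
      then obtain as bs where ab: "q = as @ y # bs" by (meson split_list)
      then have "as \<noteq> []" using q(3) y by auto
      then have "x \<in> set as" using ab q(3) by (auto simp: hd_append)
      then have "graph_path G (x # y # bs)"
        using q(1) ab fE by (auto simp: graph_path_successively successively_append_iff successively_Cons)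
      moreover have "last (x # y # bs) = c" using q(4) ab by auto
      moreover have "v \<notin> occ" if "v \<in> set (tl (x # y # bs))" for v using that q(5) ab by auto
      ultimately have "recontaminated G occ Q {(x # y # bs) ! 0, (x # y # bs) ! 1}"
        by (intro path_rec) auto
      then show ?thesis using y by simp
    qed
  qed
  show ?thesis
  proof
    fix x assume "x \<in> boundary (uncontaminated occ Q)"
    then obtain f g where f: "f \<in> Q" "\<not> recontaminated G occ Q f" "x \<in> f"
      and g: "g \<in> E" "x \<in> g" "g \<notin> uncontaminated occ Q"
      unfolding boundary_def uncontaminated_def by blast
    show "x \<in> occ"
    proof (rule ccontr)
      assume x: "x \<notin> occ"
      have "(x, c) \<in> free\<^sup>*"
      proof (cases "g \<in> Q")
        case False
        then have "x \<in> boundary Q" using f g unfolding boundary_def by blast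
        then show ?thesis using bQ x by auto
      next
        case True
        then have "recontaminated G occ Q g" using g unfolding uncontaminated_def by blast
        then obtain p j where p: "graph_path G p" "g = {p ! 0, p ! 1}" "0 < j" "Suc j < length p"
          "\<forall>i. 0 < i \<and> i \<le> j \<longrightarrow> p ! i \<notin> occ" "p ! j \<in> boundary Q"
          using recontaminated_boundary True by blast
        have pj: "p ! j = c" using p(6) p(5)[rule_format, of j] p(3) bQ by auto
        have "(p ! (j - i), c) \<in> free\<^sup>*" if "i < j" for i
          using that
        proof (induction i)
          case 0
          show ?case using pj by simp
        next
          case (Suc i)
          have "Suc (j - Suc i) = j - i" using Suc.prems by simp
          then have "{p ! (j - Suc i), p ! (j - i)} \<in> E"
            using p(1,4) unfolding graph_path_def by (metis Suc_lessD diff_le_self le_less_trans less_trans_Suc)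
          then have "(p ! (j - Suc i), p ! (j - i)) \<in> free"
            using p(5) Suc.prems unfolding free_def by simp
          then show ?case using Suc by (simp add: converse_rtrancl_into_rtrancl)
        qed
        from this[of "j - 1"] have p1: "(p ! 1, c) \<in> free\<^sup>*" using p(3) by simp
        have "p ! 1 \<notin> occ" using p(3,5) by simp
        have "x = p ! 0 \<or> x = p ! 1" using g p(2) by blast
        then show ?thesis
        proof
          assume "x = p ! 0"
          then have "(x, p ! 1) \<in> free" using g(1) p(2) x \<open>p ! 1 \<notin> occ\<close> unfolding free_def by simp
          then show ?thesis using p1 by (rule converse_rtrancl_into_rtrancl)
        qed (use p1 in simp)
      qed
      then show False using touch_rec f x by blast
    qed
  qed
qed

text \<open>The vertex \<open>c\<close> is the one that the searcher leaves, or the one that it is placed on. If \<open>c\<close> is empty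
  after the move, then each vertex \<open>d\<close> that is occupied afterwards was occupied together with \<open>c\<close> before, or
  the searcher slid along \<open>cd\<close>; in both cases an edge \<open>cd\<close>, if there is one, is clean.\<close>

lemma vacated_vertex:
  assumes "legal_move G M m"
  obtains c where "set_mset M \<subseteq> insert c (set_mset (apply_move m M))"
    "\<And>e. e \<in> slid_edges m \<Longrightarrow> e \<subseteq> insert c (set_mset (apply_move m M))"
    "c \<notin># apply_move m M \<Longrightarrow> c \<in># M"
    "\<And>d. c \<notin># apply_move m M \<Longrightarrow> d \<in># apply_move m M \<Longrightarrow> d \<in># M \<or> {c, d} \<in> slid_edges m"
proof (cases m)
  case (Place v)
  show ?thesis by (rule that[of v]) (use Place in auto)
next
  case (Delete v)
  then obtain N where N: "M = add_mset v N" using assms by (metis legal_move.simps mset_add)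
  show ?thesis by (rule that[of v]) (use Delete N in auto)
next
  case (Slide v u)
  then obtain N where N: "M = add_mset v N" using assms by (metis legal_move.simps mset_add)
  show ?thesis by (rule that[of v]) (use Slide N in auto)
qed

lemma clean_edges_guarded:
  assumes "search_strategy G S" "i \<le> length S"
  shows "clean_edges G S i \<subseteq> E \<and> boundary (clean_edges G S i) \<subseteq> set_mset (searchers S i) \<and>
    (\<forall>e\<in>E. e \<subseteq> set_mset (searchers S i) \<longrightarrow> e \<in> clean_edges G S i)"
  using assms(2)
proof (induction i)
  case 0
  have "e \<noteq> {}" if "e \<in> E" for e using that edge_nonempty by blast
  then show ?case by (auto simp: boundary_def)
next
  case (Suc i)
  define M where "M = searchers S i"
  define X where "X = clean_edges G S i"
  define m where "m = S ! i"
  define occ where "occ = set_mset (apply_move m M)"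
  define Q where "Q = X \<union> swept M m"
  have legal: "legal_move G M m"
    using assms(1) Suc.prems unfolding search_strategy_def M_def m_def by simp
  have IH: "X \<subseteq> E" "boundary X \<subseteq> set_mset M" "\<forall>e\<in>E. e \<subseteq> set_mset M \<longrightarrow> e \<in> X"
    using Suc unfolding X_def M_def by auto
  have clean: "clean_edges G S (Suc i) = uncontaminated occ Q"
    unfolding clean_edges_Suc occ_def Q_def X_def M_def m_def by simp
  have QE: "Q \<subseteq> E" using IH swept_subset[OF legal] Q_def by blast
  obtain c where c: "set_mset M \<subseteq> insert c occ" "\<And>e. e \<in> slid_edges m \<Longrightarrow> e \<subseteq> insert c occ"
    "c \<notin> occ \<Longrightarrow> c \<in># M" "\<And>d. c \<notin> occ \<Longrightarrow> d \<in> occ \<Longrightarrow> d \<in># M \<or> {c, d} \<in> slid_edges m"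
    using vacated_vertex[OF legal] unfolding occ_def by blast
  have bQ: "boundary Q \<subseteq> insert c occ"
  proof
    fix p assume "p \<in> boundary Q"
    then obtain g f where gf: "g \<in> Q" "p \<in> g" "f \<in> E" "f \<notin> Q" "p \<in> f" unfolding boundary_def by blast
    show "p \<in> insert c occ"
    proof (cases "g \<in> X")
      case True
      then have "p \<in> boundary X" using gf Q_def unfolding boundary_def by blast
      then show ?thesis using IH c by blast
    next
      case False
      then have "g \<in> swept M m" using gf Q_def by blast
      then have "g \<subseteq> insert c occ" using c(2) unfolding swept_def occ_def by blast
      then show ?thesis using gf by blast
    qed
  qed
  have "boundary (uncontaminated occ Q) \<subseteq> occ"
  proof (cases "c \<in> occ")
    case True
    then have "boundary Q \<subseteq> occ" using bQ by blast
    then show ?thesis using uncontaminated_all by simp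
  next
    case False
    show ?thesis
    proof (rule boundary_uncontaminated[OF QE False bQ])
      fix d assume d: "d \<in> occ" "{c, d} \<in> E"
      then have "d \<in># M \<or> {c, d} \<in> slid_edges m" using c(4) False by blast
      then show "{c, d} \<in> Q"
      proof
        assume "d \<in># M"
        then have "{c, d} \<subseteq> set_mset M" using c(3) False by blast
        then show ?thesis using IH(3) d(2) Q_def by blast
      qed (simp add: Q_def swept_def)
    qed
  qed
  moreover have "e \<in> uncontaminated occ Q" if "e \<in> E" "e \<subseteq> occ" for e
    using that by (intro uncontaminated_guarded) (auto simp: Q_def swept_def occ_def)
  moreover have "uncontaminated occ Q \<subseteq> E" using QE unfolding uncontaminated_def by blast
  moreover have "occ = set_mset (searchers S (Suc i))" unfolding occ_def m_def M_def by simp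
  ultimately show ?case unfolding clean by blast
qed

lemma dominated_clean_edges:
  assumes "search_strategy G S" "connected_strategy G S"
    "\<forall>i\<le>length S. size (searchers S i) \<le> 2" "i \<le> length S"
  shows "dominated (clean_edges G S i)"
  using assms(4)
proof (induction i)
  case 0
  show ?case using expansion_dominated[OF expansion.empty] by simp
next
  case (Suc i)
  let ?M = "searchers S i" and ?m = "S ! i" and ?X = "clean_edges G S i"
  let ?Q = "?X \<union> swept ?M ?m" and ?X' = "clean_edges G S (Suc i)"
  have M': "searchers S (Suc i) = apply_move ?m ?M" by simp
  have inv: "?X \<subseteq> E" "boundary ?X \<subseteq> set_mset ?M" "\<forall>e\<in>E. e \<subseteq> set_mset ?M \<longrightarrow> e \<in> ?X"
    using clean_edges_guarded[OF assms(1), of i] Suc.prems by auto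
  have inv': "boundary ?X' \<subseteq> set_mset (apply_move ?m ?M)"
    using clean_edges_guarded[OF assms(1) Suc.prems] unfolding M' by blast
  show ?case
  proof (rule dominated_move[of ?X ?M ?m ?X'])
    show "legal_move G ?M ?m" using assms(1) Suc.prems unfolding search_strategy_def by simp
    show "size ?M \<le> 2" using assms(3) Suc.prems by simp
    show "size (apply_move ?m ?M) \<le> 2" using assms(3) Suc.prems unfolding M'[symmetric] by blast
    show "?X' \<subseteq> ?Q" unfolding clean_edges_Suc uncontaminated_def by blast
    show "?X' = ?Q" if "boundary ?Q \<subseteq> set_mset (apply_move ?m ?M)"
      unfolding clean_edges_Suc M' by (rule uncontaminated_all[OF that])
    show "edge_connected ?X" "edge_connected ?X'"
      using assms(2) Suc.prems unfolding connected_strategy_def by auto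
    show "dominated ?X" using Suc by simp
  qed (use inv inv' in auto)
qed

section \<open>Monotone strategies from expansions\<close>

definition reachable :: "nat \<Rightarrow> 'a multiset \<Rightarrow> 'a set set \<Rightarrow> bool" where
  "reachable k M X \<longleftrightarrow> (\<exists>S. search_strategy G S \<and> connected_strategy G S \<and> monotone_strategy G S \<and>
     (\<forall>i\<le>length S. size (searchers S i) \<le> k) \<and>
     searchers S (length S) = M \<and> clean_edges G S (length S) = X)"

lemma searchers_append: "i \<le> length S \<Longrightarrow> searchers (S @ T) i = searchers S i"
  by (induction i) (auto simp: nth_append)

lemma clean_edges_append: "i \<le> length S \<Longrightarrow> clean_edges G (S @ T) i = clean_edges G S i"
proof (induction i)
  case (Suc i)
  then show ?case
    using searchers_append[of i S T] searchers_append[of "Suc i" S T]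
    unfolding clean_edges_Suc by (simp add: nth_append)
qed simp

lemma reachable_guarded:
  assumes "reachable k M X"
  shows "X \<subseteq> E" "boundary X \<subseteq> set_mset M" "\<And>e. e \<in> E \<Longrightarrow> e \<subseteq> set_mset M \<Longrightarrow> e \<in> X"
    "edge_connected X" "size M \<le> k"
proof -
  obtain S where S: "search_strategy G S" "connected_strategy G S"
    "\<forall>i\<le>length S. size (searchers S i) \<le> k"
    "searchers S (length S) = M" "clean_edges G S (length S) = X"
    using assms unfolding reachable_def by blast
  note guarded = clean_edges_guarded[OF S(1) order_refl, unfolded S(4,5)]
  show "X \<subseteq> E" "boundary X \<subseteq> set_mset M" using guarded by auto
  show "e \<in> X" if "e \<in> E" "e \<subseteq> set_mset M" for e using guarded that by blast
  show "edge_connected X" using S(2,5) unfolding connected_strategy_def by auto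
  show "size M \<le> k" using S(3,4) by auto
qed

lemma reachable_empty: "reachable k {#} {}"
  unfolding reachable_def
  by (rule exI[of _ "[]"])
    (simp add: search_strategy_def connected_strategy_def monotone_strategy_def edge_connected_iff)

text \<open>A move that leaves no boundary vertex unguarded recontaminates nothing, so it prolongs a
  monotone strategy.\<close>

lemma reachable_move:
  assumes "reachable k M X" "legal_move G M m" "size (apply_move m M) \<le> k"
    and bd: "boundary (X \<union> swept M m) \<subseteq> set_mset (apply_move m M)"
    and cn: "edge_connected (X \<union> swept M m)"
  shows "reachable k (apply_move m M) (X \<union> swept M m)"
proof -
  obtain S where S: "search_strategy G S" "connected_strategy G S" "monotone_strategy G S"
    "\<forall>i\<le>length S. size (searchers S i) \<le> k"
    "searchers S (length S) = M" "clean_edges G S (length S) = X"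
    using assms(1) unfolding reachable_def by blast
  define T where "T = S @ [m]"
  let ?n = "length S"
  have len: "length T = Suc ?n" unfolding T_def by simp
  have old: "searchers T i = searchers S i" "clean_edges G T i = clean_edges G S i" if "i \<le> ?n" for i
    using that searchers_append clean_edges_append unfolding T_def by auto
  have Tn: "T ! ?n = m" and Ti: "\<And>i. i < ?n \<Longrightarrow> T ! i = S ! i" unfolding T_def by (auto simp: nth_append)
  have M': "searchers T (Suc ?n) = apply_move m M" using old[of ?n] S(5) Tn by simp
  have Q: "clean_edges G T (Suc ?n) = X \<union> swept M m"
    unfolding clean_edges_Suc M' using old[of ?n] S(5,6) Tn uncontaminated_all[OF bd] by simp
  have "search_strategy G T"
    unfolding search_strategy_def len
  proof (intro allI impI)
    fix i assume "i < Suc ?n"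
    then consider "i < ?n" | "i = ?n" by linarith
    then show "legal_move G (searchers T i) (T ! i)"
    proof cases
      case 1
      then show ?thesis using S(1) old[of i] Ti unfolding search_strategy_def by simp
    next
      case 2
      then show ?thesis using assms(2) old[of ?n] S(5) Tn by simp
    qed
  qed
  moreover have "connected_strategy G T"
    unfolding connected_strategy_def len
    using S(2) old Q cn unfolding connected_strategy_def by (metis le_SucE)
  moreover have "monotone_strategy G T"
    unfolding monotone_strategy_def len
  proof
    fix i assume i: "i \<in> {1..Suc ?n}"
    show "\<not> recontamination_move G T i"
    proof (cases "i = Suc ?n")
      case True
      have "cleaned_by_move G T (Suc ?n) = swept M m"
        unfolding cleaned_by_move_def M' swept_def using Tn by simp
      then show ?thesis using True Q old[of ?n] S(6) unfolding recontamination_move_def by simp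
    next
      case False
      then have i': "i \<in> {1..?n}" using i by auto
      then have "i \<le> ?n" "i - 1 \<le> ?n" "i - 1 < ?n" by auto
      then have "recontamination_move G T i = recontamination_move G S i"
        unfolding recontamination_move_def cleaned_by_move_def
        using old[of i] old[of "i - 1"] Ti[of "i - 1"] by simp
      then show ?thesis using i' S(3) unfolding monotone_strategy_def by blast
    qed
  qed
  moreover have "size (searchers T i) \<le> k" if "i \<le> Suc ?n" for i
    using that S(4) old assms(3) M' by (metis le_SucE)
  ultimately show ?thesis unfolding reachable_def using len M' Q by metis
qed

lemma reachable_shrink:
  assumes "finite A" "reachable k (mset_set A) X" "boundary X \<subseteq> B" "B \<subseteq> A"
  shows "reachable k (mset_set B) X"
  using assms
proof (induction A rule: finite_psubset_induct)
  case (psubset A)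
  show ?case
  proof (cases "A = B")
    case True
    then show ?thesis using psubset.prems by simp
  next
    case False
    then obtain a where a: "a \<in> A" "a \<notin> B" using psubset.prems by blast
    have ap: "apply_move (Delete a) (mset_set A) = mset_set (A - {a})"
      using a psubset.hyps by (simp add: mset_set_Diff)
    note g = reachable_guarded[OF psubset.prems(1)]
    have sw: "X \<union> swept (mset_set A) (Delete a) = X"
      using g(3) psubset.hyps unfolding swept_def ap by auto
    have "size (mset_set (A - {a})) \<le> k" using g(5) a psubset.hyps by simp
    moreover have "boundary X \<subseteq> set_mset (mset_set (A - {a}))"
      using psubset.prems(2,3) psubset.hyps a by auto
    ultimately have "reachable k (mset_set (A - {a})) X"
      using reachable_move[OF psubset.prems(1), of "Delete a", unfolded ap sw]
        a psubset.hyps g(4) by simp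
    then show ?thesis using psubset.IH[of "A - {a}"] psubset.prems a by auto
  qed
qed

lemma edges_in_pair: "{f \<in> E. f \<subseteq> {a, b}} = {{a, b}} \<inter> E"
proof
  show "{f \<in> E. f \<subseteq> {a, b}} \<subseteq> {{a, b}} \<inter> E"
  proof
    fix f assume "f \<in> {f \<in> E. f \<subseteq> {a, b}}"
    then have f: "f \<in> E" "f \<subseteq> {a, b}" by auto
    then obtain p q where "f = {p, q}" "p \<noteq> q" using edge_card by (meson card_2_iff)
    then show "f \<in> {{a, b}} \<inter> E" using f by auto
  qed
qed auto

lemma edges_in_singleton: "{f \<in> E. f \<subseteq> {a}} = {}"
  using edges_in_pair[of a a] edge_distinct[of a a] by auto

lemma edge_connected_add_chords:
  assumes "edge_connected Y" "\<Union>F \<subseteq> \<Union>Y"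
  shows "edge_connected (Y \<union> F)"
  unfolding edge_connected_iff
proof (intro ballI)
  fix a b assume "a \<in> \<Union>(Y \<union> F)" "b \<in> \<Union>(Y \<union> F)"
  then have "(a, b) \<in> (adj Y)\<^sup>*" using assms unfolding edge_connected_iff by blast
  then show "(a, b) \<in> (adj (Y \<union> F))\<^sup>*" by (rule adj_rtrancl_mono) simp
qed

text \<open>An edge between two occupied vertices is clean whether or not the expansion has added it yet, so a
  strategy can run ahead of the expansion \<open>Y\<close> by such edges.\<close>

definition guarded_closure :: "'a set set \<Rightarrow> 'a set \<Rightarrow> 'a set set" where
  "guarded_closure Y A = Y \<union> {e \<in> E. e \<subseteq> A}"

text \<open>An edge within \<open>A\<close> that is missing in \<open>Y\<close> joins two covered vertices, which are therefore boundary
  vertices. So the closure does not change when the searchers outside the boundary are deleted.\<close>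

lemma reachable_normalise:
  assumes "reachable k (mset_set A) (guarded_closure Y A)" "finite A" "A \<subseteq> \<Union>Y" "boundary Y \<subseteq> A"
  shows "reachable k (mset_set (boundary Y)) (guarded_closure Y (boundary Y))"
proof -
  have eq: "guarded_closure Y A = guarded_closure Y (boundary Y)"
    using assms(3,4) unfolding guarded_closure_def boundary_def by blast
  have "\<Union>(guarded_closure Y (boundary Y)) = \<Union>Y"
    unfolding guarded_closure_def boundary_def by blast
  then have "boundary (guarded_closure Y (boundary Y)) \<subseteq> boundary Y"
    unfolding boundary_def[of "guarded_closure _ _"] unfolding guarded_closure_def
    unfolding boundary_def by blast
  then show ?thesis using reachable_shrink[OF assms(2) assms(1)[unfolded eq]] assms(4) by blast
qed

text \<open>Between two stages the searchers stand exactly on the boundary. An edge step is void if both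
  endpoints are already guarded. Otherwise it is a placement if at most one vertex is guarded. If
  two are guarded, the bound in the edge step forces \<open>e\<close> to be the last dirty edge at its covered
  endpoint, and the searcher standing there slides along it.\<close>

lemma expansion_reachable:
  assumes "expansion Y"
  shows "reachable 2 (mset_set (boundary Y)) (guarded_closure Y (boundary Y))"
  using assms
proof (induction rule: expansion.induct)
  case empty
  have "guarded_closure {} {} = {}" using edge_nonempty unfolding guarded_closure_def by blast
  then show ?case using reachable_empty by (simp add: boundary_def)
next
  case (edge Y Y')
  have YE: "Y \<subseteq> E" using edge expansion_subset by blast
  obtain e where e: "e \<in> E" "e \<notin> Y" "Y' = insert e Y" "card (boundary Y' \<union> (e - \<Union>Y)) \<le> 2"
    and cn: "edge_connected Y'"
    using edge.hyps(2) unfolding edge_step_def by auto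
  have norm: ?case if "reachable 2 (mset_set A) (guarded_closure Y' A)" "finite A" "A \<subseteq> \<Union>Y'" "boundary Y' \<subseteq> A" for A
    using reachable_normalise that by blast
  show ?case
  proof (cases "Y = {}")
    case True
    obtain a where a: "a \<in> e" using edge_nonempty e by blast
    then obtain b where b: "e = {a, b}" "b \<noteq> a" using edge_other_end e by metis
    have abV: "a \<in> verts G" "b \<in> verts G" using edge_verts e b by blast+
    have s1: "{} \<union> swept {#} (Place a) = {}" unfolding swept_def using edges_in_singleton by simp
    have "reachable 2 {#a#} {}"
      using reachable_move[OF reachable_empty, of "Place a" 2, unfolded s1] abV
      by (simp add: boundary_def edge_connected_iff)
    moreover have s2: "{} \<union> swept {#a#} (Place b) = Y'"
      unfolding swept_def using edges_in_pair[of b a] e b True by (auto simp: insert_commute)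
    ultimately have "reachable 2 {#b, a#} Y'"
      using reachable_move[of 2 "{#a#}" "{}" "Place b", unfolded s2] abV cn e b True
      by (simp add: boundary_def insert_commute)
    moreover have "{#b, a#} = mset_set {a, b}" using b by (simp add: insert_commute)
    moreover have "guarded_closure Y' {a, b} = Y'"
      unfolding guarded_closure_def edges_in_pair using e b by auto
    ultimately show ?thesis using norm[of "{a, b}"] e b True by (auto simp: boundary_def)
  next
    case False
    have "\<Union>{e} \<inter> \<Union>Y \<noteq> {}"
      by (rule edge_connected_meet) (use cn e YE False Union_nonempty edge_nonempty in auto)
    then obtain a where a: "a \<in> e" "a \<in> \<Union>Y" by blast
    then obtain b where b: "e = {a, b}" "b \<noteq> a" using edge_other_end e by metis
    have abV: "a \<in> verts G" "b \<in> verts G" using edge_verts e b by blast+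
    have abd: "a \<in> boundary Y" using a e unfolding boundary_def by blast
    show ?thesis
    proof (cases "b \<in> \<Union>Y")
      case True
      then have "b \<in> boundary Y" using b e unfolding boundary_def by blast
      then have "e \<subseteq> boundary Y" using abd b by blast
      then have "guarded_closure Y' (boundary Y) = guarded_closure Y (boundary Y)"
        unfolding guarded_closure_def using e by blast
      moreover have "boundary Y' \<subseteq> boundary Y" using boundary_insert[of e Y] \<open>e \<subseteq> boundary Y\<close> e(3) by blast
      moreover have "boundary Y \<subseteq> \<Union>Y'" unfolding boundary_def using e(3) by blast
      ultimately show ?thesis using norm[of "boundary Y"] edge.IH finite_boundary by simp
    next
      case bY: False
      show ?thesis
      proof (cases "card (boundary Y) \<le> 1")
        case True
        then have bdY: "boundary Y = {a}" using boundary_eq_singleton abd by blast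
        have "guarded_closure Y {a} = Y" unfolding guarded_closure_def edges_in_singleton by simp
        then have "reachable 2 {#a#} Y" using edge.IH bdY by simp
        moreover have s2: "Y \<union> swept {#a#} (Place b) = Y'"
          unfolding swept_def using edges_in_pair[of b a] e b by (auto simp: insert_commute)
        moreover have bd': "boundary Y' \<subseteq> {a, b}" using boundary_insert[of e Y] bdY b e(3) by blast
        ultimately have "reachable 2 {#b, a#} Y'"
          using reachable_move[of 2 "{#a#}" Y "Place b", unfolded s2] abV cn
          by (simp add: insert_commute)
        moreover have "{#b, a#} = mset_set {a, b}" using b by (simp add: insert_commute)
        moreover have "guarded_closure Y' {a, b} = Y'"
          unfolding guarded_closure_def edges_in_pair using e b by auto
        ultimately show ?thesis using norm[of "{a, b}"] e b bd' by auto
      next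
        case False
        have "card (boundary Y) = 2" using False expansion_boundary edge.hyps(1) by fastforce
        then have "card (boundary Y - {a}) = 1" using abd finite_boundary by simp
        then obtain c where "boundary Y - {a} = {c}" by (auto simp: card_1_singleton_iff)
        then have bdY: "boundary Y = {a, c}" and ca: "c \<noteq> a" using abd by auto
        have cY: "c \<in> \<Union>Y" using bdY unfolding boundary_def by blast
        then have cb: "c \<noteq> b" using bY by blast
        have "boundary Y - {a} \<subseteq> boundary Y'"
        proof
          fix p assume "p \<in> boundary Y - {a}"
          then obtain g f where "g \<in> Y" "p \<in> g" "f \<in> E" "f \<notin> Y" "p \<in> f" "p \<noteq> a"
            unfolding boundary_def by blast
          moreover from this have "f \<noteq> e" using b bY by auto
          ultimately show "p \<in> boundary Y'" using e(3) unfolding boundary_def by blast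
        qed
        then have cY': "c \<in> boundary Y'" using bdY ca by blast
        \<comment> \<open>the searcher on \<open>a\<close> can leave, since \<open>b\<close> and \<open>c\<close> already use up the bound\<close>
        have aY': "a \<notin> boundary Y'"
        proof
          assume "a \<in> boundary Y'"
          then have "{a, b, c} \<subseteq> boundary Y' \<union> (e - \<Union>Y)" using cY' b bY by blast
          then have "card {a, b, c} \<le> card (boundary Y' \<union> (e - \<Union>Y))"
            using finite_boundary edge_finite e by (intro card_mono) auto
          then show False using e(4) b(2) ca cb by simp
        qed
        have aall: "f \<in> Y'" if "f \<in> E" "a \<in> f" for f
          using aY' that e(3) a unfolding boundary_def by blast
        have "{{a, c}} \<inter> E \<subseteq> Y"
        proof
          fix f assume f: "f \<in> {{a, c}} \<inter> E"
          then have "f \<in> Y'" using aall by blast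
          moreover have "f \<noteq> e" using f b cb ca by (auto simp: doubleton_eq_iff)
          ultimately show "f \<in> Y" using e(3) by blast
        qed
        then have "guarded_closure Y {a, c} = Y" unfolding guarded_closure_def edges_in_pair by blast
        moreover have "mset_set {a, c} = {#a, c#}" using ca by simp
        ultimately have r0: "reachable 2 {#a, c#} Y" using edge.IH bdY by simp
        have s1: "Y \<union> swept {#a, c#} (Slide a b) = guarded_closure Y' {b, c}"
          unfolding swept_def guarded_closure_def using e(3) b by auto
        have "boundary Y' \<subseteq> {a, b, c}" using boundary_insert[of e Y] bdY b(1) e(3) by auto
        then have bd': "boundary Y' \<subseteq> {b, c}" using aY' by blast
        have "boundary (guarded_closure Y' {b, c}) \<subseteq> {b, c}"
        proof
          fix p assume p: "p \<in> boundary (guarded_closure Y' {b, c})"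
          show "p \<in> {b, c}"
          proof (rule ccontr)
            assume np: "p \<notin> {b, c}"
            have "p \<in> boundary Y'" using p np unfolding boundary_def guarded_closure_def by blast
            then show False using bd' np by blast
          qed
        qed
        moreover have bcY': "{b, c} \<subseteq> \<Union>Y'" using cY b e(3) by auto
        moreover from this have "edge_connected (guarded_closure Y' {b, c})"
          unfolding guarded_closure_def using cn by (intro edge_connected_add_chords) auto
        ultimately have "reachable 2 {#b, c#} (guarded_closure Y' {b, c})"
          using reachable_move[OF r0, of "Slide a b", unfolded s1] e(1) b by simp
        moreover have "{#b, c#} = mset_set {b, c}" using cb by simp
        ultimately show ?thesis using norm[of "{b, c}"] bcY' bd' by simp
      qed
    qed
  qed
next
  case (leaf Y Y')
  obtain u v w where s: "Y' = Y \<union> {{u, w}, {u, v}}" "{u, w} \<in> E" "{u, v} \<in> E" "boundary Y = {w}"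
     "u \<notin> \<Union>Y" "\<forall>f\<in>E. v \<in> f \<longrightarrow> f = {u, v}" and cn: "edge_connected Y'"
    using leaf.hyps(2) unfolding leaf_step_def by blast
  have wY: "w \<in> \<Union>Y" using s(4) unfolding boundary_def by blast
  then have uw: "u \<noteq> w" using s(5) by blast
  have uv: "u \<noteq> v" using s(3) edge_distinct by blast
  have vwE: "{v, w} \<notin> E"
  proof
    assume "{v, w} \<in> E"
    then have "{v, w} = {u, v}" using s(6)[rule_format, of "{v, w}"] by simp
    then show False using uw uv by (auto simp: doubleton_eq_iff)
  qed
  have vw: "v \<noteq> w" using wY s(5,6) expansion_subset[OF leaf.hyps(1)] by blast
  have vV: "v \<in> verts G" using edge_verts s(3) by blast
  have "guarded_closure Y {w} = Y" unfolding guarded_closure_def edges_in_singleton by simp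
  then have r0: "reachable 2 {#w#} Y" using leaf.IH s(4) by simp
  have s1: "Y \<union> swept {#w#} (Place v) = Y"
    unfolding swept_def using edges_in_pair[of v w] vwE by auto
  have "reachable 2 {#v, w#} Y"
    using reachable_move[OF r0, of "Place v", unfolded s1] vV s(4) expansion_connected leaf.hyps(1) by simp
  moreover have s2: "Y \<union> swept {#v, w#} (Slide v u) = Y'"
    unfolding swept_def using edges_in_pair[of u w] s(1,2) by (auto simp: insert_commute)
  moreover have bd': "boundary Y' \<subseteq> {u, w}"
  proof
    fix p assume p: "p \<in> boundary Y'"
    then obtain f where f: "f \<in> E" "p \<in> f" "f \<notin> Y'" unfolding boundary_def by blast
    then have pv: "p \<noteq> v" using s(1,6) by blast
    show "p \<in> {u, w}"
    proof (rule ccontr)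
      assume np: "p \<notin> {u, w}"
      then have "p \<in> \<Union>Y" using p pv s(1) unfolding boundary_def by blast
      then have "p \<in> boundary Y" using f s(1) unfolding boundary_def by blast
      then show False using s(4) np by blast
    qed
  qed
  ultimately have "reachable 2 {#u, w#} Y'"
    using reachable_move[of 2 "{#v, w#}" Y "Slide v u", unfolded s2] cn s(3) by (simp add: insert_commute)
  moreover have "{#u, w#} = mset_set {u, w}" using uw by simp
  moreover have "guarded_closure Y' {u, w} = Y'"
    unfolding guarded_closure_def edges_in_pair using s(1) by auto
  moreover have "{u, w} \<subseteq> \<Union>Y'" using s(1) by auto
  ultimately show ?case using reachable_normalise[of 2 "{u, w}" Y'] bd' by simp
qed

section \<open>Comparing the two parameters\<close>

text \<open>Without a bound on their number, searchers are placed on all vertices one after the other, each but the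
  first next to an occupied one. This shows that the minimum in the definition of \<open>cmms\<close> is taken over a nonempty set.\<close>

lemma reachable_complete: "reachable (card (verts G)) (mset_set (verts G)) E"
proof -
  let ?V = "verts G" and ?I = "\<lambda>A. {e \<in> E. e \<subseteq> A}"
  have finV: "finite ?V" using simple unfolding simple_graph_def by blast
  have "\<exists>A\<subseteq>?V. card A = n \<and> (\<forall>x\<in>A. \<forall>y\<in>A. (x, y) \<in> (adj (?I A))\<^sup>*) \<and>
      reachable (card ?V) (mset_set A) (?I A)" if "n \<le> card ?V" for n
    using that
  proof (induction n)
    case 0
    have I0: "?I {} = {}" using edge_nonempty by blast
    have "reachable (card ?V) (mset_set {}) (?I {})"
      unfolding I0 mset_set.empty by (rule reachable_empty)
    then show ?case by (intro exI[of _ "{}"] conjI) simp_all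
  next
    case (Suc n)
    then obtain A where A: "A \<subseteq> ?V" "card A = n" "\<And>x y. x \<in> A \<Longrightarrow> y \<in> A \<Longrightarrow> (x, y) \<in> (adj (?I A))\<^sup>*"
      "reachable (card ?V) (mset_set A) (?I A)" by auto
    have finA: "finite A" using A(1) finV finite_subset by blast
    have "A \<noteq> ?V" using Suc.prems A(2) by auto
    then obtain t where t: "t \<in> ?V" "t \<notin> A" using A(1) by blast
    obtain v where v: "v \<in> ?V" "v \<notin> A" "A = {} \<or> (\<exists>a\<in>A. {a, v} \<in> E)"
    proof (cases "\<exists>a\<in>A. \<exists>v. v \<notin> A \<and> {a, v} \<in> E")
      case True
      then show ?thesis using that edge_verts by blast
    next
      case closed: False
      have "A = {}"
      proof (rule ccontr)
        assume "A \<noteq> {}"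
        then obtain a where a: "a \<in> A" by blast
        then have "(a, t) \<in> (adj E)\<^sup>*"
          using connected t(1) A(1) unfolding connected_graph_def adj_def by blast
        then have "t \<in> A"
        proof (induction rule: rtrancl_induct)
          case base
          show ?case by (rule a)
        next
          case (step y z)
          then show ?case using closed unfolding adj_def by blast
        qed
        then show False using t(2) by blast
      qed
      then show ?thesis using that t by blast
    qed
    let ?B = "insert v A"
    \<comment> \<open>a vertex that every vertex of \<open>?B\<close> reaches within \<open>?B\<close>\<close>
    have hub: "\<exists>a\<in>?B. \<forall>x\<in>?B. (x, a) \<in> (adj (?I ?B))\<^sup>*"
    proof (cases "A = {}")
      case True
      then show ?thesis by simp
    next
      case False
      then obtain a where a: "a \<in> A" "{a, v} \<in> E" using v by blast
      have "(x, a) \<in> (adj (?I ?B))\<^sup>*" if "x \<in> A" for x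
        using A(3)[OF that a(1)] by (rule adj_rtrancl_mono) auto
      moreover have "(v, a) \<in> adj (?I ?B)" using a unfolding adj_def by (auto simp: insert_commute)
      ultimately show ?thesis using a(1) by blast
    qed
    then have conB: "(x, y) \<in> (adj (?I ?B))\<^sup>*" if "x \<in> ?B" "y \<in> ?B" for x y
      using that adj_rtrancl_sym rtrancl_trans by meson
    have sizeB: "card ?B \<le> card ?V" using A(1) v(1) finV by (intro card_mono) auto
    have ap: "apply_move (Place v) (mset_set A) = mset_set ?B" using finA v(2) by simp
    have sw: "?I A \<union> swept (mset_set A) (Place v) = ?I ?B"
      unfolding swept_def ap using finA by auto
    have "boundary (?I ?B) \<subseteq> ?B" unfolding boundary_def by blast
    moreover have "edge_connected (?I ?B)"
      unfolding edge_connected_iff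
    proof (intro ballI)
      fix x y assume "x \<in> \<Union>(?I ?B)" "y \<in> \<Union>(?I ?B)"
      then show "(x, y) \<in> (adj (?I ?B))\<^sup>*" by (intro conB) blast+
    qed
    ultimately have "reachable (card ?V) (mset_set ?B) (?I ?B)"
      using reachable_move[OF A(4), of "Place v", unfolded ap sw] v(1) finA sizeB by simp
    moreover have "card ?B = Suc n" using finA v(2) A(2) by simp
    moreover have "?B \<subseteq> ?V" using A(1) v(1) by blast
    ultimately show ?case using conB by blast
  qed
  from this[OF order_refl] obtain A where A: "A \<subseteq> ?V" "card A = card ?V" "reachable (card ?V) (mset_set A) (?I A)" by blast
  then have "A = ?V" using finV by (simp add: card_subset_eq)
  moreover have "?I ?V = E" using edge_verts by blast
  ultimately show ?thesis using A(3) by simp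
qed

lemma cmms_le_if_reachable:
  assumes "reachable k M E"
  shows "cmms G \<le> k"
proof -
  obtain S where S: "search_strategy G S" "connected_strategy G S" "monotone_strategy G S"
    "\<forall>i\<le>length S. size (searchers S i) \<le> k" "clean_edges G S (length S) = E"
    using assms unfolding reachable_def by blast
  have "complete_strategy G S" using S(5) unfolding complete_strategy_def by blast
  then have "cmms G \<le> searchers_used S" unfolding cmms_def using S by (intro Least_le) blast
  also have "\<dots> \<le> k" unfolding searchers_used_def using S(4) by simp
  finally show ?thesis .
qed

lemma cmms_attained:
  obtains S where "search_strategy G S" "complete_strategy G S" "connected_strategy G S"
    "monotone_strategy G S" "searchers_used S = cmms G"
proof -
  obtain S where S: "search_strategy G S" "connected_strategy G S" "monotone_strategy G S"
    "clean_edges G S (length S) = E"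
    using reachable_complete unfolding reachable_def by blast
  have "complete_strategy G S" using S(4) unfolding complete_strategy_def by blast
  then have "\<exists>k S. search_strategy G S \<and> complete_strategy G S \<and>
     connected_strategy G S \<and> monotone_strategy G S \<and> searchers_used S = k"
    using S by blast
  from LeastI_ex[OF this] show ?thesis using that unfolding cmms_def[symmetric] by blast
qed

lemma cms_le_cmms: "cms G \<le> cmms G"
proof -
  obtain S where "search_strategy G S" "complete_strategy G S" "connected_strategy G S"
    "searchers_used S = cmms G" using cmms_attained by blast
  then show ?thesis unfolding cms_def by (intro Least_le) blast
qed

lemma cms_attained:
  obtains S where "search_strategy G S" "complete_strategy G S" "connected_strategy G S"
    "searchers_used S = cms G"
proof -
  have "\<exists>k S. search_strategy G S \<and> complete_strategy G S \<and>
     connected_strategy G S \<and> searchers_used S = k"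
    using cmms_attained by blast
  from LeastI_ex[OF this] show ?thesis using that unfolding cms_def[symmetric] by blast
qed

lemma cmms_le_2_iff: "cmms G \<le> 2 \<longleftrightarrow> cms G \<le> 2"
proof
  assume "cmms G \<le> 2"
  then show "cms G \<le> 2" using cms_le_cmms by linarith
next
  assume le: "cms G \<le> 2"
  obtain S where S: "search_strategy G S" "complete_strategy G S" "connected_strategy G S"
    "searchers_used S = cms G" using cms_attained by blast
  have "size (searchers S i) \<le> 2" if "i \<le> length S" for i
  proof -
    have "size (searchers S i) \<le> searchers_used S"
      unfolding searchers_used_def using that by (intro Max_ge) auto
    then show ?thesis using S(4) le by linarith
  qed
  moreover obtain i where "i \<le> length S" "clean_edges G S i = E"
    using S(2) unfolding complete_strategy_def by blast
  ultimately have "dominated E" using dominated_clean_edges[OF S(1,3)] by metis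
  then have "expansion E"
    using expansion.empty expansion_subset unfolding dominated_def by (metis subset_antisym)
  then have "reachable 2 (mset_set (boundary E)) (guarded_closure E (boundary E))"
    by (rule expansion_reachable)
  moreover have "guarded_closure E (boundary E) = E" unfolding guarded_closure_def by blast
  ultimately show "cmms G \<le> 2" using cmms_le_if_reachable by simp
qed

end

text \<open>An edge between different fibres makes the union of the two fibres connected, so its image is an edge of
  \<open>H\<close>. Thus walks in \<open>G\<close> are mapped to walks in \<open>H\<close>.\<close>

lemma contraction_connected:
  assumes "H \<preceq>\<^sub>c G" "connected_graph G"
  shows "connected_graph H"
proof -
  obtain \<phi> where img: "\<phi> ` verts G = verts H"
    and fib: "\<And>v. v \<in> verts H \<Longrightarrow> connected_graph (induced_subgraph G {x \<in> verts G. \<phi> x = v})"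
    and edg: "\<And>u v. u \<in> verts H \<Longrightarrow> v \<in> verts H \<Longrightarrow> u \<noteq> v \<Longrightarrow> {u, v} \<in> edges H \<longleftrightarrow>
       connected_graph (induced_subgraph G {x \<in> verts G. \<phi> x = u \<or> \<phi> x = v})"
    and simple: "simple_graph G"
    using assms(1) unfolding contraction_def by blast
  have step: "(\<phi> x, \<phi> y) \<in> (adj (edges H))\<^sup>*" if xy: "{x, y} \<in> edges G" for x y
  proof (cases "\<phi> x = \<phi> y")
    case True
    then show ?thesis by simp
  next
    case False
    have V: "x \<in> verts G" "y \<in> verts G" using simple xy unfolding simple_graph_def by blast+
    then have W: "\<phi> x \<in> verts H" "\<phi> y \<in> verts H" using img by blast+
    let ?W = "{z \<in> verts G. \<phi> z = \<phi> x \<or> \<phi> z = \<phi> y}"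
    let ?F = "{e \<in> edges G. e \<subseteq> ?W}"
    have in_fibre: "(p, q) \<in> (adj ?F)\<^sup>*"
      if "p \<in> verts G" "q \<in> verts G" "\<phi> p = \<phi> q" "\<phi> q = \<phi> x \<or> \<phi> q = \<phi> y" for p q
    proof -
      have "connected_graph (induced_subgraph G {z \<in> verts G. \<phi> z = \<phi> q})" using fib that W by auto
      then have "(p, q) \<in> (adj {e \<in> edges G. e \<subseteq> {z \<in> verts G. \<phi> z = \<phi> q}})\<^sup>*"
        using that unfolding connected_graph_def induced_subgraph_def adj_def by auto
      then show ?thesis by (rule adj_rtrancl_mono) (use that in auto)
    qed
    have "(y, x) \<in> adj ?F" using xy V unfolding adj_def by (auto simp: insert_commute)
    then have yx: "(y, x) \<in> (adj ?F)\<^sup>*" by (rule r_into_rtrancl)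
    have to_x: "(p, x) \<in> (adj ?F)\<^sup>*" if "p \<in> ?W" for p
    proof (cases "\<phi> p = \<phi> x")
      case True
      then show ?thesis using in_fibre that V by auto
    next
      case False
      then have "(p, y) \<in> (adj ?F)\<^sup>*" using in_fibre that V by auto
      then show ?thesis using yx by (rule rtrancl_trans)
    qed
    have "(p, q) \<in> (adj ?F)\<^sup>*" if "p \<in> ?W" "q \<in> ?W" for p q
      using to_x[OF that(1)] adj_rtrancl_sym[OF to_x[OF that(2)]] by (rule rtrancl_trans)
    then have "connected_graph (induced_subgraph G ?W)"
      unfolding connected_graph_def induced_subgraph_def adj_def by auto
    then have "{\<phi> x, \<phi> y} \<in> edges H" using edg W False by blast
    then show ?thesis unfolding adj_def by auto
  qed
  show ?thesis
    unfolding connected_graph_def adj_def[symmetric]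
  proof (intro ballI)
    fix u v assume "u \<in> verts H" "v \<in> verts H"
    then obtain x y where xy: "x \<in> verts G" "y \<in> verts G" "u = \<phi> x" "v = \<phi> y" using img by blast
    then have "(x, y) \<in> (adj (edges G))\<^sup>*"
      using assms(2) unfolding connected_graph_def adj_def by blast
    then have "(\<phi> x, \<phi> y) \<in> (adj (edges H))\<^sup>*"
      by (rule rtrancl_image) (simp add: adj_def[of "edges G"] step)
    then show "(u, v) \<in> (adj (edges H))\<^sup>*" using xy by simp
  qed
qed

theorem corollary1:
  shows "contraction_obs cmms 2 = contraction_obs cms 2"
proof -
  have same: "cmms G \<le> 2 \<longleftrightarrow> cms G \<le> 2" if "simple_graph G" "connected_graph G" for G :: "nat graph"
    using connected_simple_graph.cmms_le_2_iff[of G] that connected_simple_graph.intro by blast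
  have minor: "cmms H \<le> 2 \<longleftrightarrow> cms H \<le> 2"
    if "proper_contraction H G" "connected_graph G" for H G :: "nat graph"
  proof (rule same)
    have c: "H \<preceq>\<^sub>c G" using that(1) unfolding proper_contraction_def by blast
    then show "simple_graph H" unfolding contraction_def by blast
    show "connected_graph H" by (rule contraction_connected[OF c that(2)])
  qed
  have "simple_graph G \<and> connected_graph G \<and> cmms G > 2 \<and>
        (\<forall>H :: nat graph. proper_contraction H G \<longrightarrow> cmms H \<le> 2) \<longleftrightarrow>
      simple_graph G \<and> connected_graph G \<and> cms G > 2 \<and>
        (\<forall>H :: nat graph. proper_contraction H G \<longrightarrow> cms H \<le> 2)" for G :: "nat graph"
  proof (cases "simple_graph G \<and> connected_graph G")
    case True
    then have "(\<forall>H :: nat graph. proper_contraction H G \<longrightarrow> cmms H \<le> 2) \<longleftrightarrow>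
        (\<forall>H :: nat graph. proper_contraction H G \<longrightarrow> cms H \<le> 2)"
      using minor by blast
    moreover have "cmms G > 2 \<longleftrightarrow> cms G > 2" using True same by (meson not_le)
    ultimately show ?thesis by blast
  qed blast
  then show ?thesis unfolding contraction_obs_def by simp
qed

end
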